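(* For every nonnegative integer $n$, \[ \sum_{T\in \mathrm{PT}_B(n)} y^{2\operatorname{row}(T)+\operatorname{diag}(T)}\,t^{\operatorname{diag}(T)}\,q^{\operatorname{so}(T)} \;=\;\sum_{\pi\in B_n} y^{\operatorname{fwex}(\pi)}\,t^{\operatorname{neg}(\pi)}\,q^{\operatorname{cro}(\pi)} . \] Equivalently, for every $k$, the coefficient of $y^k$ in the left-hand side equals $\sum_{\pi\in B_n,\ \operatorname{fwex}(\pi)=k} t^{\operatorname{neg}(\pi)}q^{\operatorname{cro}(\pi)}$.
   Context: A Ferrers diagram is a top- and left-justified array of unit cells with weakly decreasing row lengths (empty rows and columns are allowed); its length is the number of rows plus the number of columns. For a Ferrers diagram $F$ with $k$ columns, the shifted diagram $\overline F$ is obtained by adding above $F$ $k$ new left-justified rows of lengths $1,2,\dots,k$ (from top to bottom); the rightmost cell of an added row is a diagonal cell (so the diagonal cell of column $j$ is its top cell). The length of $\overline F$ is that of $F$. A type $B$ permutation tableau of length $n$ is a $0,1$-filling of such an $\overline F$ of length $n$ such that (1) each column contains at least one $1$; (2) no $0$ has both a $1$ above it in its column and a $1$ to its left in its row; (3) a $0$ in a diagonal cell has no $1$ to its left in its row. $\mathrm{PT}_B(n)$ is the set of these. For such $T$: a $1$ is superfluous if there is a $1$ above it in its column, $\operatorname{so}(T)$ is the number of superfluous $1$'s, $\operatorname{row}(T)$ is the number of rows of $F$ (the added rows not counted, empty rows counted), and $\operatorname{diag}(T)$ is the number of $1$'s in diagonal cells. A signed permutation of $[n]$ is a word $\pi=\pi_1\cdots\pi_n$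 of nonzero integers such that $|\pi_1|\cdots|\pi_n|$ is a permutation of $[n]$; $B_n$ is the set of these. Statistics: $\operatorname{wex}(\pi)=\#\{i\in[n]:\pi_i\ge i\}$, $\operatorname{neg}(\pi)=\#\{i\in[n]:\pi_i<0\}$, $\operatorname{fwex}(\pi)=2\operatorname{wex}(\pi)+\operatorname{neg}(\pi)$. A crossing of $\pi$ is a pair $(i,j)$ of positive integers in $[n]$ such that $i<j\le\pi_i<\pi_j$, or $-i<j\le-\pi_i<\pi_j$, or $i>j>\pi_i>\pi_j$; $\operatorname{cro}(\pi)$ is the number of crossings. *)

theory Defs
  imports "HOL-Combinatorics.Multiset_Permutations" "HOL-Computational_Algebra.Polynomial"
    "HOL-Library.FuncSet"
begin

(* A Ferrers diagram is the pair of its list of row lengths (empty rows allowed) and its number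
   of columns, which may exceed the first row length because empty columns are allowed. *)
type_synonym ferrers = "nat list \<times> nat"

definition is_ferrers :: "ferrers \<Rightarrow> bool" where
  "is_ferrers F \<longleftrightarrow> sorted_wrt (\<ge>) (fst F) \<and> (\<forall>r\<in>set (fst F). r \<le> snd F)"

definition ferrers_length :: "ferrers \<Rightarrow> nat" where
  "ferrers_length F = length (fst F) + snd F"

definition shifted_rows :: "ferrers \<Rightarrow> nat list" where
  "shifted_rows F = [1..<Suc (snd F)] @ fst F"

(* Cells (i, j) = (row, column) are numbered from 0, rows from top to bottom; the added row i has
   length i + 1. *)
definition shifted_cells :: "ferrers \<Rightarrow> (nat \<times> nat) set" where
  "shifted_cells F = {(i, j). i < length (shifted_rows F) \<and> j < shifted_rows F ! i}"

definition diagonal_cells :: "ferrers \<Rightarrow> (nat \<times> nat) set" where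
  "diagonal_cells F = {(j, j) | j. j < snd F}"

type_synonym tableau = "ferrers \<times> (nat \<times> nat \<Rightarrow> nat)"

definition one_above :: "tableau \<Rightarrow> nat \<Rightarrow> nat \<Rightarrow> bool" where
  "one_above T i j \<longleftrightarrow> (\<exists>i'<i. (i', j) \<in> shifted_cells (fst T) \<and> snd T (i', j) = 1)"

definition one_left :: "tableau \<Rightarrow> nat \<Rightarrow> nat \<Rightarrow> bool" where
  "one_left T i j \<longleftrightarrow> (\<exists>j'<j. (i, j') \<in> shifted_cells (fst T) \<and> snd T (i, j') = 1)"

(* Fillings lie in an extensional function space, so each filling is represented exactly once. *)
definition PT_B :: "nat \<Rightarrow> tableau set" where
  "PT_B n = {T. is_ferrers (fst T) \<and> ferrers_length (fst T) = n \<and>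
     snd T \<in> shifted_cells (fst T) \<rightarrow>\<^sub>E {0, 1} \<and>
     (\<forall>j<snd (fst T). \<exists>i. (i, j) \<in> shifted_cells (fst T) \<and> snd T (i, j) = 1) \<and>
     (\<forall>(i, j)\<in>shifted_cells (fst T). snd T (i, j) = 0 \<longrightarrow> \<not> (one_above T i j \<and> one_left T i j)) \<and>
     (\<forall>(i, j)\<in>diagonal_cells (fst T). snd T (i, j) = 0 \<longrightarrow> \<not> one_left T i j)}"

definition tab_so :: "tableau \<Rightarrow> nat" where
  "tab_so T = card {(i, j). (i, j) \<in> shifted_cells (fst T) \<and> snd T (i, j) = 1 \<and> one_above T i j}"

definition tab_row :: "tableau \<Rightarrow> nat" where
  "tab_row T = length (fst (fst T))"

definition tab_diag :: "tableau \<Rightarrow> nat" where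
  "tab_diag T = card {c \<in> diagonal_cells (fst T). snd T c = 1}"

(* The letters are automatically nonzero, and the words have length n. *)
definition signed_perms :: "nat \<Rightarrow> int list set" where
  "signed_perms n = {w. map abs w \<in> permutations_of_set {1..int n}}"

(* sp_letter w i is the i-th letter, for i in {1..length w}. *)
definition sp_letter :: "int list \<Rightarrow> nat \<Rightarrow> int" where
  "sp_letter w i = w ! (i - 1)"

definition sp_wex :: "int list \<Rightarrow> nat" where
  "sp_wex w = card {i \<in> {1..length w}. sp_letter w i \<ge> int i}"

definition sp_neg :: "int list \<Rightarrow> nat" where
  "sp_neg w = card {i \<in> {1..length w}. sp_letter w i < 0}"

definition sp_fwex :: "int list \<Rightarrow> nat" where
  "sp_fwex w = 2 * sp_wex w + sp_neg w"

definition is_crossing :: "int list \<Rightarrow> nat \<Rightarrow> nat \<Rightarrow> bool" where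
  "is_crossing w i j \<longleftrightarrow>
     (int i < int j \<and> int j \<le> sp_letter w i \<and> sp_letter w i < sp_letter w j) \<or>
     (- int i < int j \<and> int j \<le> - sp_letter w i \<and> - sp_letter w i < sp_letter w j) \<or>
     (int i > int j \<and> int j > sp_letter w i \<and> sp_letter w i > sp_letter w j)"

definition sp_cro :: "int list \<Rightarrow> nat" where
  "sp_cro w = card {(i, j). i \<in> {1..length w} \<and> j \<in> {1..length w} \<and> is_crossing w i j}"

lemma signed_perms_nonzero: "w \<in> signed_perms n \<Longrightarrow> 0 \<notin> set w"
  by (force simp: signed_perms_def permutations_of_set_def)

lemma length_signed_perms: "w \<in> signed_perms n \<Longrightarrow> length w = n"
  using distinct_card[of "map abs w"] by (simp add: signed_perms_def permutations_of_set_def)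

lemma finite_signed_perms: "finite (signed_perms n)"
proof (rule finite_subset)
  show "signed_perms n \<subseteq> {w. set w \<subseteq> {- int n..int n} \<and> length w = n}"
  proof
    fix w assume w: "w \<in> signed_perms n"
    have "abs ` set w = {1..int n}"
      using w by (simp add: signed_perms_def permutations_of_set_def)
    then have "\<bar>x\<bar> \<in> {1..int n}" if "x \<in> set w" for x
      using that by blast
    then have "set w \<subseteq> {- int n..int n}" by fastforce
    then show "w \<in> {w. set w \<subseteq> {- int n..int n} \<and> length w = n}"
      using length_signed_perms[OF w] by simp
  qed
qed (simp add: finite_lists_length_eq)

lemma finite_shifted_cells: "finite (shifted_cells F)"
proof (rule finite_subset)
  show "shifted_cells F \<subseteq> (SIGMA i:{..<length (shifted_rows F)}. {..<shifted_rows F ! i})"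
    by (auto simp: shifted_cells_def)
qed simp

lemma diagonal_cells_subset: "diagonal_cells F \<subseteq> shifted_cells F"
  by (auto simp: diagonal_cells_def shifted_cells_def shifted_rows_def nth_append simp del: upt_Suc)

lemma finite_PT_B: "finite (PT_B n)"
proof -
  let ?X = "{l. set l \<subseteq> {..n} \<and> length l \<le> n} \<times> {..n}"
  show ?thesis
  proof (rule finite_subset)
    show "PT_B n \<subseteq> (SIGMA F:?X. shifted_cells F \<rightarrow>\<^sub>E {0, 1})"
    proof
      fix T assume "T \<in> PT_B n"
      then have "is_ferrers (fst T)" and len: "ferrers_length (fst T) = n"
        and fill: "snd T \<in> shifted_cells (fst T) \<rightarrow>\<^sub>E {0, 1}"
        unfolding PT_B_def by blast+
      then have "\<forall>r\<in>set (fst (fst T)). r \<le> n"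
        by (force simp: is_ferrers_def ferrers_length_def)
      with len have "fst T \<in> ?X"
        by (cases "fst T") (auto simp: ferrers_length_def)
      with fill show "T \<in> (SIGMA F:?X. shifted_cells F \<rightarrow>\<^sub>E {0, 1})"
        by (cases T) simp
    qed
    show "finite (SIGMA F:?X. shifted_cells F \<rightarrow>\<^sub>E {0, 1 :: nat})"
      by (intro finite_SigmaI finite_PiE finite_shifted_cells finite_cartesian_product
          finite_lists_length_le) auto
  qed
qed

end

theory Submission
  imports Defs
begin

text \<open>
Let \<open>[h] = 1 + q + \<dots> + q\<^sup>h\<^sup>-\<^sup>1\<close> and let \<open>D\<close>, \<open>E\<close> act on sequences by
\<open>(f D)(h) = [h + 1] f(h) + [h]\<^sup>2 f(h - 1)\<close> and \<open>(f E)(h) = f(h + 1) + [h] f(h)\<close>, so that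
\<open>D E = q E D + D + E\<close>. For \<open>w(h) = s\<^sup>h [h]!\<close> with \<open>s = y t\<close> one has \<open>w E = s w D\<close>, and both sides
equal \<open>(w (E + y\<^sup>2 D)\<^sup>n)(0)\<close>.

For signed permutations, treat the positions and the absolute values \<open>n, n - 1, \<dots>, 1\<close> in this order
and let \<open>h\<close> be the number of treated positions (equivalently, of treated values) that are not matched
to each other by a positive letter; the \<open>h\<close> positions left at the end carry the negative letters.

For tableaux, the last step of the border path of \<open>F\<close> is an empty row or a leftmost column. The new column may have
its ones only in the new diagonal cell and in the rows where a new leftmost one violates no rule; a
tableau with \<open>u\<close> such rows contributes \<open>w D\<^sup>u\<close>, and commuting \<open>D\<^sup>u\<close> past \<open>E\<close> produces exactly the sum
over all fillings of the new column.
\<close>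

section \<open>The operators\<close>

definition qint :: "'a::comm_ring_1 \<Rightarrow> nat \<Rightarrow> 'a" where
  "qint q n = (\<Sum>i<n. q ^ i)"

lemma qint_0 [simp]: "qint q 0 = 0"
  by (simp add: qint_def)

lemma qint_Suc: "qint q (Suc n) = 1 + q * qint q n"
  by (simp add: qint_def sum.lessThan_Suc_shift sum_distrib_left del: sum.lessThan_Suc)

lemma qint_Suc': "qint q (Suc n) = qint q n + q ^ n"
  by (simp add: qint_def)

text \<open>The ranks in a set of size m are 0, ..., m - 1; the induction adds a new maximum, whose
  rank is the old size. Such ranks later count the crossings created by one letter.\<close>

lemma sum_power_rank:
  fixes A :: "nat set"
  assumes "finite A"
  shows "(\<Sum>p\<in>A. q ^ card {x \<in> A. x < p}) = qint q (card A)"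
  using assms
proof (induction rule: finite_linorder_max_induct)
  case (insert b A)
  have "b \<notin> A" using insert by blast
  have "{x \<in> insert b A. x < b} = A" using insert by auto
  moreover have "{x \<in> insert b A. x < p} = {x \<in> A. x < p}" if "p \<in> A" for p
    using insert that by auto
  ultimately show ?case using insert \<open>b \<notin> A\<close>
    by (simp add: qint_Suc')
qed simp

lemma sum_power_corank:
  fixes A :: "nat set"
  assumes "finite A"
  shows "(\<Sum>p\<in>A. q ^ card {x \<in> A. p < x}) = qint q (card A)"
  using assms
proof (induction rule: finite_linorder_min_induct)
  case (insert b A)
  have "b \<notin> A" using insert by blast
  have "{x \<in> insert b A. b < x} = A" using insert by auto
  moreover have "{x \<in> insert b A. p < x} = {x \<in> A. p < x}" if "p \<in> A" for p
    using insert that by auto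
  ultimately show ?case using insert \<open>b \<notin> A\<close>
    by (simp add: qint_Suc')
qed simp

text \<open>At \<open>h = 0\<close> the truncated \<open>h - 1\<close> is harmless, because its
  coefficient \<open>qint q 0\<close> is 0.\<close>

definition opD :: "'a::comm_ring_1 \<Rightarrow> (nat \<Rightarrow> 'a) \<Rightarrow> nat \<Rightarrow> 'a" where
  "opD q f h = qint q (Suc h) * f h + (qint q h)\<^sup>2 * f (h - 1)"

definition opE :: "'a::comm_ring_1 \<Rightarrow> (nat \<Rightarrow> 'a) \<Rightarrow> nat \<Rightarrow> 'a" where
  "opE q f h = f (Suc h) + qint q h * f h"

definition opM :: "'a::comm_ring_1 \<Rightarrow> 'a \<Rightarrow> (nat \<Rightarrow> 'a) \<Rightarrow> nat \<Rightarrow> 'a" where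
  "opM Y q f h = opE q f h + Y * opD q f h"

text \<open>Grouped as two half steps for signed permutations: the outer \<open>qint q h\<close>
  belongs to matching the current value, and each factor \<open>Y * qint q _\<close> to matching the
  current position afterwards.\<close>

lemma opM_apply:
  "opM Y q f h = f (Suc h) + Y * qint q (Suc h) * f h + qint q h * (f h + Y * qint q h * f (h - 1))"
  by (simp add: opM_def opE_def opD_def algebra_simps power2_eq_square)

text \<open>The commutation relation of the overview. There the operators act from the right, so
  products appear here in the opposite order.\<close>

lemma opE_opD: "opE q (opD q f) h = q * opD q (opE q f) h + opD q f h + opE q f h"
proof (cases h)
  case 0
  then show ?thesis by (simp add: opD_def opE_def qint_Suc algebra_simps power2_eq_square)
next
  case (Suc k)
  then show ?thesis
    by (simp add: opD_def opE_def qint_Suc algebra_simps power2_eq_square)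
qed

lemma opE_opD_fun: "opE q (opD q f) = (\<lambda>h. q * opD q (opE q f) h + opD q f h + opE q f h)"
  by (rule ext) (rule opE_opD)

lemma opD_lin: "opD q (\<lambda>h. a * f h + b * g h) = (\<lambda>h. a * opD q f h + b * opD q g h)"
  by (rule ext) (simp add: opD_def algebra_simps)

lemma opD_funpow_lin:
  "(opD q ^^ j) (\<lambda>h. a * f h + b * g h) = (\<lambda>h. a * (opD q ^^ j) f h + b * (opD q ^^ j) g h)"
  by (induction j) (simp_all add: opD_lin)

text \<open>See \<open>sum_Pow_card\<close> and \<open>sum_Pow_nonempty_card\<close> below for the subset sums computed by \<open>phi\<close> and \<open>psi\<close>.\<close>

primrec phi :: "'a::comm_ring_1 \<Rightarrow> nat \<Rightarrow> (nat \<Rightarrow> 'a) \<Rightarrow> 'a" where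
  "phi q 0 g = g 0"
| "phi q (Suc u) g = phi q u g + q * phi q u (\<lambda>j. g (Suc j))"

primrec psi :: "'a::comm_ring_1 \<Rightarrow> nat \<Rightarrow> (nat \<Rightarrow> 'a) \<Rightarrow> 'a" where
  "psi q 0 g = 0"
| "psi q (Suc u) g = phi q u (\<lambda>j. g (Suc j)) + psi q u (\<lambda>j. g (Suc j))"

lemma phi_lin: "phi q u (\<lambda>j. a * f j + b * g j) = a * phi q u f + b * phi q u g"
  by (induction u arbitrary: f g) (simp_all add: algebra_simps)

lemma phi_scale: "phi q u (\<lambda>j. a * f j) = a * phi q u f"
  using phi_lin[of q u a f 0 f] by simp

text \<open>Moving \<open>opE\<close> past one \<open>opD\<close> leaves three terms. The two that
  keep \<open>opE\<close> build the recursion of \<open>phi\<close>; the one that loses it joins the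
  rest to build the recursion of \<open>psi\<close>.\<close>

lemma opE_opD_funpow:
  "opE q ((opD q ^^ u) f) h = phi q u (\<lambda>j. (opD q ^^ j) (opE q f) h) + psi q u (\<lambda>j. (opD q ^^ j) f h)"
proof (induction u arbitrary: f)
  case (Suc u)
  \<comment> \<open>The factors 1 give the shape \<open>a * f + b * g\<close>, twice nested, that
    \<open>opD_funpow_lin\<close> and then \<open>phi_lin\<close> match.\<close>
  have lin: "(opD q ^^ j) (opE q (opD q f)) h =
      1 * (q * (opD q ^^ Suc j) (opE q f) h + 1 * (opD q ^^ j) (opE q f) h) + 1 * (opD q ^^ Suc j) f h" for j
  proof -
    have "opE q (opD q f) = (\<lambda>h. 1 * (q * opD q (opE q f) h + 1 * opE q f h) + 1 * opD q f h)"
      by (simp add: opE_opD_fun algebra_simps)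
    then show ?thesis
      by (simp only: opD_funpow_lin funpow_Suc_right o_apply)
  qed
  have "opE q ((opD q ^^ Suc u) f) h = opE q ((opD q ^^ u) (opD q f)) h"
    by (simp add: funpow_swap1)
  also have "\<dots> = phi q u (\<lambda>j. (opD q ^^ j) (opE q (opD q f)) h)
      + psi q u (\<lambda>j. (opD q ^^ j) (opD q f) h)"
    by (rule Suc.IH)
  also have "(\<lambda>j. (opD q ^^ j) (opD q f) h) = (\<lambda>j. (opD q ^^ Suc j) f h)"
    by (simp add: funpow_swap1)
  finally show ?case
    unfolding lin phi_lin phi.simps psi.simps by (simp only: algebra_simps mult_1)
qed simp

section \<open>Subset sums behind \<open>phi\<close> and \<open>psi\<close>\<close>

lemma inj_on_insert_Pow:
  assumes "x \<notin> U"
  shows "inj_on (insert x) (Pow U)"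
  using assms by (intro inj_onI) (metis Diff_insert_absorb PowD subsetD)

text \<open>The two summands in the recursion of \<open>phi\<close> are the subsets without and with
  a fixed element.\<close>

lemma sum_Pow_card:
  fixes q :: "'a::comm_ring_1"
  assumes "finite U"
  shows "(\<Sum>C\<in>Pow U. q ^ card C * g (card C)) = phi q (card U) g"
  using assms
proof (induction arbitrary: g)
  case (insert x U)
  have "(\<Sum>C\<in>Pow (insert x U). q ^ card C * g (card C)) =
      (\<Sum>C\<in>Pow U. q ^ card C * g (card C)) + (\<Sum>C\<in>insert x ` Pow U. q ^ card C * g (card C))"
    unfolding Pow_insert using insert by (intro sum.union_disjoint) auto
  also have "(\<Sum>C\<in>insert x ` Pow U. q ^ card C * g (card C)) =
      (\<Sum>C\<in>Pow U. q ^ card (insert x C) * g (card (insert x C)))"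
    using insert by (intro sum.reindex_cong[of "insert x"]) (auto intro: inj_on_insert_Pow)
  also have "\<dots> = (\<Sum>C\<in>Pow U. q * (q ^ card C * g (Suc (card C))))"
  proof (intro sum.cong refl)
    fix C assume "C \<in> Pow U"
    then have "finite C" "x \<notin> C" using insert by (auto intro: finite_subset)
    then show "q ^ card (insert x C) * g (card (insert x C)) = q * (q ^ card C * g (Suc (card C)))"
      by (simp add: algebra_simps)
  qed
  finally show ?case using insert
    by (simp add: insert.IH[of "\<lambda>j. g (Suc j)"] flip: sum_distrib_left)
qed simp

text \<open>A set \<open>insert x C\<close> is never empty, so only the second sum still has to
  exclude \<open>{}\<close>.\<close>

lemma sum_Pow_insert_nonempty:
  fixes f :: "'b set \<Rightarrow> 'a::comm_monoid_add"
  assumes "finite U" "x \<notin> U"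
  shows "(\<Sum>C\<in>Pow (insert x U) - {{}}. f C) = (\<Sum>C\<in>Pow U. f (insert x C)) + (\<Sum>C\<in>Pow U - {{}}. f C)"
proof -
  have "Pow (insert x U) - {{}} = insert x ` Pow U \<union> (Pow U - {{}})"
    unfolding Pow_insert by auto
  then have "(\<Sum>C\<in>Pow (insert x U) - {{}}. f C) = (\<Sum>C\<in>insert x ` Pow U. f C) + (\<Sum>C\<in>Pow U - {{}}. f C)"
    using assms by (simp only:) (intro sum.union_disjoint, auto)
  also have "(\<Sum>C\<in>insert x ` Pow U. f C) = (\<Sum>C\<in>Pow U. f (insert x C))"
    using assms by (intro sum.reindex_cong[of "insert x"]) (auto intro: inj_on_insert_Pow)
  finally show ?thesis .
qed

lemma sum_Pow_insert_card:
  fixes q :: "'a::comm_ring_1"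
  assumes "finite U" "x \<notin> U"
  shows "(\<Sum>C\<in>Pow U. q ^ (card (insert x C) - 1) * g (card (insert x C))) = phi q (card U) (\<lambda>j. g (Suc j))"
  unfolding sum_Pow_card[OF assms(1), symmetric]
proof (intro sum.cong refl)
  fix C assume "C \<in> Pow U"
  then have "finite C" "x \<notin> C" using assms by (auto intro: finite_subset)
  then show "q ^ (card (insert x C) - 1) * g (card (insert x C)) = q ^ card C * g (Suc (card C))"
    by simp
qed

text \<open>Induction by a new minimum \<open>b\<close>. If \<open>b\<close> is in \<open>C\<close>,
  nothing lies below all of \<open>C\<close> and a \<open>phi\<close> sum remains; otherwise
  \<open>b\<close> itself lies below all of \<open>C\<close> and shifts the argument of
  \<open>g\<close> by one. For tableaux, \<open>C\<close> will be the rows of the ones in a new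
  column.\<close>

lemma sum_Pow_nonempty_card:
  fixes q :: "'a::comm_ring_1" and U :: "nat set"
  assumes "finite U"
  shows "(\<Sum>C\<in>Pow U - {{}}. q ^ (card C - 1) * g (card (C \<union> {i \<in> U. \<forall>c\<in>C. i < c}))) = psi q (card U) g"
  using assms
proof (induction arbitrary: g rule: finite_linorder_min_induct)
  case (insert b A)
  have b: "b \<notin> A" using insert by blast
  have "(\<Sum>C\<in>Pow A. q ^ (card (insert b C) - 1) *
        g (card (insert b C \<union> {i \<in> insert b A. \<forall>c\<in>insert b C. i < c}))) =
      (\<Sum>C\<in>Pow A. q ^ (card (insert b C) - 1) * g (card (insert b C)))"
  proof (intro sum.cong refl arg_cong2[where f = "(*)"] arg_cong[where f = g] arg_cong[where f = card])
    fix C assume "C \<in> Pow A"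
    then show "insert b C \<union> {i \<in> insert b A. \<forall>c\<in>insert b C. i < c} = insert b C"
      using insert by auto
  qed
  moreover have "(\<Sum>C\<in>Pow A - {{}}. q ^ (card C - 1) *
        g (card (C \<union> {i \<in> insert b A. \<forall>c\<in>C. i < c}))) =
      (\<Sum>C\<in>Pow A - {{}}. q ^ (card C - 1) * g (Suc (card (C \<union> {i \<in> A. \<forall>c\<in>C. i < c}))))"
  proof (intro sum.cong refl arg_cong2[where f = "(*)"] arg_cong[where f = g])
    fix C assume "C \<in> Pow A - {{}}"
    then have "C \<union> {i \<in> insert b A. \<forall>c\<in>C. i < c} = insert b (C \<union> {i \<in> A. \<forall>c\<in>C. i < c})"
      and "finite (C \<union> {i \<in> A. \<forall>c\<in>C. i < c})" and "b \<notin> C \<union> {i \<in> A. \<forall>c\<in>C. i < c}"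
      using insert by (auto intro: finite_subset)
    then show "card (C \<union> {i \<in> insert b A. \<forall>c\<in>C. i < c}) = Suc (card (C \<union> {i \<in> A. \<forall>c\<in>C. i < c}))"
      by simp
  qed
  ultimately show ?case
    using insert.hyps(1) b
    by (simp add: sum_Pow_insert_nonempty sum_Pow_insert_card insert.IH[of "\<lambda>j. g (Suc j)"]
        del: One_nat_def)
qed simp

lemma opM_sum:
  "opM Y q (\<lambda>h. \<Sum>a\<in>A. c a * f a h) h = (\<Sum>a\<in>A. c a * opM Y q (f a) h)"
  unfolding opM_apply sum_distrib_left sum.distrib[symmetric]
  by (intro sum.cong refl) (simp add: algebra_simps)

text \<open>The sequence \<open>w\<close> of the overview; by \<open>sum_smatch_neg\<close> it
  enumerates the words with \<open>h\<close> letters, all negative.\<close>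

definition neg_wt :: "'a::comm_ring_1 \<Rightarrow> 'a \<Rightarrow> nat \<Rightarrow> 'a" where
  "neg_wt s q h = s ^ h * (\<Prod>i<h. qint q (Suc i))"

text \<open>Holds summand by summand, since \<open>w(h + 1) = s [h + 1] w(h)\<close>.\<close>

lemma opE_neg_wt: "opE q (neg_wt s q) = (\<lambda>h. s * opD q (neg_wt s q) h)"
proof
  show "opE q (neg_wt s q) h = s * opD q (neg_wt s q) h" for h
    by (cases h) (simp_all add: opE_def opD_def neg_wt_def algebra_simps power2_eq_square)
qed

text \<open>The bridge to tableaux: by \<open>sum_col_choices\<close>, the right-hand side is the
  sum over all fillings of a new column. The \<open>phi\<close> part has a one in the new diagonal
  cell, whence the factor \<open>s\<close>; the \<open>psi\<close> part has a zero there.\<close>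

lemma opE_opD_funpow_neg_wt:
  "opE q ((opD q ^^ u) (neg_wt s q)) h =
    s * phi q u (\<lambda>j. (opD q ^^ Suc j) (neg_wt s q) h) + psi q u (\<lambda>j. (opD q ^^ j) (neg_wt s q) h)"
proof -
  have "(opD q ^^ j) (opE q (neg_wt s q)) h = s * (opD q ^^ Suc j) (neg_wt s q) h" for j
    \<comment> \<open>Scaling is obtained from the two-term linearity with a zero second
      term.\<close>
    using opD_funpow_lin[of j q s "opD q (neg_wt s q)" 0 "\<lambda>_. 0"]
    by (simp add: opE_neg_wt funpow_swap1)
  then show ?thesis
    by (simp only: opE_opD_funpow phi_scale)
qed

section \<open>Signed permutations\<close>

text \<open>Graphs \<open>{(i, \<pi>\<^sub>i) | i \<in> P}\<close> of words with positions in \<open>P\<close> and absolute values in \<open>V\<close>. Keeping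
  arbitrary \<open>P\<close> and \<open>V\<close> makes it possible to delete letters without standardizing.\<close>

definition smatch :: "nat set \<Rightarrow> nat set \<Rightarrow> (nat \<times> int) set set" where
  "smatch P V = {G. bij_betw fst G P \<and> bij_betw (\<lambda>c. nat \<bar>snd c\<bar>) G V}"

lemma finite_smatch_mem: "G \<in> smatch P V \<Longrightarrow> finite P \<Longrightarrow> finite G"
  by (auto simp: smatch_def dest: bij_betw_finite)

lemma smatch_mem:
  assumes "G \<in> smatch P V" "(i, a) \<in> G"
  shows "i \<in> P \<and> nat \<bar>a\<bar> \<in> V"
proof -
  have "bij_betw fst G P" "bij_betw (\<lambda>c. nat \<bar>snd c\<bar>) G V"
    using assms by (simp_all add: smatch_def)
  from bij_betwE[OF this(1)] bij_betwE[OF this(2)] show ?thesis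
    using assms(2) by (metis fst_conv snd_conv)
qed

lemma smatch_position_unique:
  assumes "G \<in> smatch P V" "(i, a) \<in> G" "(i, b) \<in> G"
  shows "a = b"
proof -
  have "inj_on fst G" using assms by (simp add: smatch_def bij_betw_def)
  from inj_onD[OF this, of "(i, a)" "(i, b)"] assms show ?thesis by simp
qed

lemma smatch_value_unique:
  assumes "G \<in> smatch P V" "(i, a) \<in> G" "(j, b) \<in> G" "\<bar>a\<bar> = \<bar>b\<bar>"
  shows "i = j \<and> a = b"
proof -
  have "inj_on (\<lambda>c. nat \<bar>snd c\<bar>) G" using assms by (simp add: smatch_def bij_betw_def)
  from inj_onD[OF this, of "(i, a)" "(j, b)"] assms show ?thesis by simp
qed

lemma smatch_position_ex:
  assumes "G \<in> smatch P V" "i \<in> P"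
  shows "\<exists>a. (i, a) \<in> G"
proof -
  have "i \<in> fst ` G" using assms by (simp add: smatch_def bij_betw_def)
  then show ?thesis by auto
qed

lemma finite_smatch:
  assumes "finite P" "finite V"
  shows "finite (smatch P V)"
proof (rule finite_subset)
  show "smatch P V \<subseteq> Pow (P \<times> (int ` V \<union> (\<lambda>v. - int v) ` V))"
  proof (intro subsetI PowI)
    fix G c assume G: "G \<in> smatch P V" and "c \<in> G"
    then have "fst c \<in> P" "nat \<bar>snd c\<bar> \<in> V" using smatch_mem[OF G, of "fst c" "snd c"] by auto
    moreover have "snd c = int v \<or> snd c = - int v" if "v = nat \<bar>snd c\<bar>" for v
      using that by linarith
    ultimately show "c \<in> P \<times> (int ` V \<union> (\<lambda>v. - int v) ` V)"
      by (metis UnI1 UnI2 image_eqI mem_Times_iff)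
  qed
qed (use assms in simp)

lemma smatch_insert:
  assumes "p \<in> P" "nat \<bar>x\<bar> \<in> V"
  shows "{G \<in> smatch P V. (p, x) \<in> G} = insert (p, x) ` smatch (P - {p}) (V - {nat \<bar>x\<bar>})"
proof (intro equalityI subsetI)
  fix G assume "G \<in> {G \<in> smatch P V. (p, x) \<in> G}"
  then have G: "bij_betw fst G P" "bij_betw (\<lambda>c. nat \<bar>snd c\<bar>) G V" and px: "(p, x) \<in> G"
    by (auto simp: smatch_def)
  have "bij_betw fst (G - {(p, x)}) (P - {p})"
    by (rule bij_betw_DiffI[OF G(1)]) (use px assms in auto)
  moreover have "bij_betw (\<lambda>c. nat \<bar>snd c\<bar>) (G - {(p, x)}) (V - {nat \<bar>x\<bar>})"
    by (rule bij_betw_DiffI[OF G(2)]) (use px assms in auto)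
  ultimately have "G - {(p, x)} \<in> smatch (P - {p}) (V - {nat \<bar>x\<bar>})"
    by (simp add: smatch_def)
  moreover have "G = insert (p, x) (G - {(p, x)})" using px by auto
  ultimately show "G \<in> insert (p, x) ` smatch (P - {p}) (V - {nat \<bar>x\<bar>})" by blast
next
  fix G assume "G \<in> insert (p, x) ` smatch (P - {p}) (V - {nat \<bar>x\<bar>})"
  then obtain H where H: "bij_betw fst H (P - {p})"
      "bij_betw (\<lambda>c. nat \<bar>snd c\<bar>) H (V - {nat \<bar>x\<bar>})" and G: "G = H \<union> {(p, x)}"
    by (auto simp: smatch_def)
  have "bij_betw fst G ((P - {p}) \<union> {p})"
    unfolding G by (rule bij_betw_combine[OF H(1)]) auto
  moreover have "bij_betw (\<lambda>c. nat \<bar>snd c\<bar>) G ((V - {nat \<bar>x\<bar>}) \<union> {nat \<bar>x\<bar>})"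
    unfolding G by (rule bij_betw_combine[OF H(2)]) auto
  ultimately show "G \<in> {G \<in> smatch P V. (p, x) \<in> G}"
    using assms G by (simp add: smatch_def insert_absorb)
qed

text \<open>Removal of a prescribed letter as a change of variables; \<open>Q\<close> and
  \<open>R\<close> will be the cut conditions before and after the removal.\<close>

lemma sum_smatch_insert:
  assumes "p \<in> P" "nat \<bar>x\<bar> \<in> V"
    and "\<And>G. G \<in> smatch (P - {p}) (V - {nat \<bar>x\<bar>}) \<Longrightarrow> Q (insert (p, x) G) \<longleftrightarrow> R G"
  shows "(\<Sum>G\<in>{G \<in> smatch P V. (p, x) \<in> G \<and> Q G}. f G) =
    (\<Sum>G\<in>{G \<in> smatch (P - {p}) (V - {nat \<bar>x\<bar>}). R G}. f (insert (p, x) G))"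
proof (rule sum.reindex_cong[of "insert (p, x)"])
  have "{G \<in> smatch P V. (p, x) \<in> G \<and> Q G} = {G \<in> {G \<in> smatch P V. (p, x) \<in> G}. Q G}"
    by simp
  also have "\<dots> = insert (p, x) ` {G \<in> smatch (P - {p}) (V - {nat \<bar>x\<bar>}). R G}"
    unfolding smatch_insert[OF assms(1,2)] using assms(3) by auto
  finally show "{G \<in> smatch P V. (p, x) \<in> G \<and> Q G} =
      insert (p, x) ` {G \<in> smatch (P - {p}) (V - {nat \<bar>x\<bar>}). R G}" .
  have "(p, x) \<notin> G" if "G \<in> smatch (P - {p}) (V - {nat \<bar>x\<bar>})" for G
    using smatch_mem[OF that, of p x] by auto
  then show "inj_on (insert (p, x)) {G \<in> smatch (P - {p}) (V - {nat \<bar>x\<bar>}). R G}"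
    by (intro inj_onI) (simp add: insert_ident)
qed simp

section \<open>Crossings and weights of graphs, one letter at a time\<close>

definition crosses :: "nat \<times> int \<Rightarrow> nat \<times> int \<Rightarrow> bool" where
  "crosses = (\<lambda>(i, a) (j, b).
     (int i < int j \<and> int j \<le> a \<and> a < b) \<or>
     (- int i < int j \<and> int j \<le> - a \<and> - a < b) \<or>
     (int i > int j \<and> int j > a \<and> a > b))"

text \<open>The substitution \<open>Y = y\<^sup>2\<close>, \<open>s = y * t\<close> turns
  \<open>Y\<close> and \<open>s\<close> into the weights of \<open>fwex\<close> and
  \<open>neg\<close>, as \<open>fwex\<close> is twice \<open>wex\<close> plus
  \<open>neg\<close>.\<close>

definition match_wt :: "'a::comm_ring_1 \<Rightarrow> 'a \<Rightarrow> 'a \<Rightarrow> (nat \<times> int) set \<Rightarrow> 'a" where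
  "match_wt Y s q G = Y ^ card {(i, a) \<in> G. int i \<le> a} * s ^ card {(i, a) \<in> G. a < 0} *
     q ^ card {(c, d) \<in> G \<times> G. crosses c d}"

text \<open>No letter crosses itself, so the new crossings are those with the new letter first and
  those with it second.\<close>

lemma match_wt_insert:
  assumes "finite G" "(p, x) \<notin> G"
  shows "match_wt Y s q (insert (p, x) G) =
    (if int p \<le> x then Y else 1) * (if x < 0 then s else 1) *
    q ^ (card {d \<in> G. crosses (p, x) d} + card {d \<in> G. crosses d (p, x)}) * match_wt Y s q G"
proof -
  have "{(i, a) \<in> insert (p, x) G. int i \<le> a} =
      (if int p \<le> x then insert (p, x) {(i, a) \<in> G. int i \<le> a} else {(i, a) \<in> G. int i \<le> a})"
    by auto
  moreover have "finite {(i, a) \<in> G. int i \<le> a}" "finite {(i, a) \<in> G. a < 0}"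
    using assms(1) by (auto intro: finite_subset)
  ultimately have 1: "Y ^ card {(i, a) \<in> insert (p, x) G. int i \<le> a} =
      (if int p \<le> x then Y else 1) * Y ^ card {(i, a) \<in> G. int i \<le> a}"
    using assms by simp
  have "{(i, a) \<in> insert (p, x) G. a < 0} =
      (if x < 0 then insert (p, x) {(i, a) \<in> G. a < 0} else {(i, a) \<in> G. a < 0})"
    by auto
  then have 2: "s ^ card {(i, a) \<in> insert (p, x) G. a < 0} =
      (if x < 0 then s else 1) * s ^ card {(i, a) \<in> G. a < 0}"
    using assms \<open>finite {(i, a) \<in> G. a < 0}\<close> by simp
  have "\<not> crosses (p, x) (p, x)" by (auto simp: crosses_def)
  then have eq: "{(c, d) \<in> insert (p, x) G \<times> insert (p, x) G. crosses c d} =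
      {(c, d) \<in> G \<times> G. crosses c d} \<union>
      (Pair (p, x) ` {d \<in> G. crosses (p, x) d} \<union> (\<lambda>d. (d, (p, x))) ` {d \<in> G. crosses d (p, x)})"
    by auto
  have fin: "finite {(c, d) \<in> G \<times> G. crosses c d}"
    by (rule finite_subset[of _ "G \<times> G"]) (use assms in auto)
  have "card {(c, d) \<in> insert (p, x) G \<times> insert (p, x) G. crosses c d} =
      card {(c, d) \<in> G \<times> G. crosses c d} +
      card (Pair (p, x) ` {d \<in> G. crosses (p, x) d} \<union> (\<lambda>d. (d, (p, x))) ` {d \<in> G. crosses d (p, x)})"
    unfolding eq by (rule card_Un_disjoint) (use fin assms in auto)
  also have "card (Pair (p, x) ` {d \<in> G. crosses (p, x) d} \<union> (\<lambda>d. (d, (p, x))) ` {d \<in> G. crosses d (p, x)}) =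
      card (Pair (p, x) ` {d \<in> G. crosses (p, x) d}) + card ((\<lambda>d. (d, (p, x))) ` {d \<in> G. crosses d (p, x)})"
    by (rule card_Un_disjoint) (use assms in auto)
  also have "\<dots> = card {d \<in> G. crosses (p, x) d} + card {d \<in> G. crosses d (p, x)}"
    by (intro arg_cong2[where f = "(+)"] card_image) (auto simp: inj_on_def)
  finally have 3: "card {(c, d) \<in> insert (p, x) G \<times> insert (p, x) G. crosses c d} =
      card {(c, d) \<in> G \<times> G. crosses c d} + (card {d \<in> G. crosses (p, x) d} + card {d \<in> G. crosses d (p, x)})" .
  show ?thesis
    unfolding match_wt_def 1 2 3 by (simp add: power_add mult_ac)
qed

text \<open>Together with \<open>card_smatch_value\<close>, this turns the number of letters
  crossing a given one into a rank in \<open>P\<close> or in \<open>V\<close>.\<close>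

lemma card_smatch_position:
  assumes "G \<in> smatch P V"
  shows "card {c \<in> G. Q (fst c)} = card {i \<in> P. Q i}"
proof -
  have "bij_betw fst {c \<in> G. Q (fst c)} {i \<in> P. Q i}"
    using assms unfolding smatch_def bij_betw_def by (auto simp: inj_on_def)
  then show ?thesis by (rule bij_betw_same_card)
qed

lemma card_smatch_value:
  assumes "G \<in> smatch P V"
  shows "card {c \<in> G. Q (nat \<bar>snd c\<bar>)} = card {v \<in> V. Q v}"
proof -
  have "bij_betw (\<lambda>c. nat \<bar>snd c\<bar>) {c \<in> G. Q (nat \<bar>snd c\<bar>)} {v \<in> V. Q v}"
    using assms unfolding smatch_def bij_betw_def by (auto simp: inj_on_def)
  then show ?thesis by (rule bij_betw_same_card)
qed

text \<open>The positions greater than \<open>a\<close> and the values greater than \<open>b\<close> have been treated and are unmatched.\<close>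

definition smatch_cut :: "nat set \<Rightarrow> nat set \<Rightarrow> nat \<Rightarrow> nat \<Rightarrow> (nat \<times> int) set set" where
  "smatch_cut P V a b = {G \<in> smatch P V. \<forall>(i, x)\<in>G. a < i \<longrightarrow> x \<le> int b}"

section \<open>Recursions for treating one value, one position, or one negative letter\<close>

lemma finite_smatch_cut: "finite P \<Longrightarrow> finite V \<Longrightarrow> finite (smatch_cut P V a b)"
  unfolding smatch_cut_def by (simp add: finite_smatch)

text \<open>Treats the value \<open>Suc k\<close>: either it stays open, or it is the letter of
  exactly one open position \<open>p\<close>. In the latter case \<open>p > Suc k\<close>, so there
  is no factor \<open>Y\<close>, and the crossings are with the open positions before
  \<open>p\<close>.\<close>

lemma sum_smatch_cut_value:
  assumes P: "finite P" "0 \<notin> P" and V: "finite V" "0 \<notin> V" "Suc k \<in> V"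
  shows "sum (match_wt Y s q) (smatch_cut P V (Suc k) (Suc k)) =
    sum (match_wt Y s q) (smatch_cut P V (Suc k) k) +
    (\<Sum>p\<in>{p \<in> P. Suc k < p}. q ^ card {j \<in> P. Suc k < j \<and> j < p} *
      sum (match_wt Y s q) (smatch_cut (P - {p}) (V - {Suc k}) (Suc k) k))"
proof -
  define A where "A p = {G \<in> smatch P V. (p, int (Suc k)) \<in> G \<and> (\<forall>(i, x)\<in>G. Suc k < i \<longrightarrow> x \<le> int (Suc k))}" for p
  have split: "smatch_cut P V (Suc k) (Suc k) = smatch_cut P V (Suc k) k \<union> (\<Union>p\<in>{p \<in> P. Suc k < p}. A p)"
  proof (intro equalityI subsetI)
    fix G assume G: "G \<in> smatch_cut P V (Suc k) (Suc k)"
    show "G \<in> smatch_cut P V (Suc k) k \<union> (\<Union>p\<in>{p \<in> P. Suc k < p}. A p)"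
    proof (cases "\<exists>p>Suc k. (p, int (Suc k)) \<in> G")
      case True
      then show ?thesis using G smatch_mem[of G P V] by (auto simp: smatch_cut_def A_def)
    next
      case False
      then have "x \<le> int k" if "(i, x) \<in> G" "Suc k < i" for i x
        using G that by (cases "x = int (Suc k)") (fastforce simp: smatch_cut_def)+
      then show ?thesis using G by (auto simp: smatch_cut_def)
    qed
  next
    fix G assume "G \<in> smatch_cut P V (Suc k) k \<union> (\<Union>p\<in>{p \<in> P. Suc k < p}. A p)"
    then show "G \<in> smatch_cut P V (Suc k) (Suc k)"
      by (fastforce simp: smatch_cut_def A_def)
  qed
  have fin: "finite (A p)" for p
    using P V finite_smatch[of P V] by (simp add: A_def)
  have "sum (match_wt Y s q) (smatch_cut P V (Suc k) (Suc k)) =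
      sum (match_wt Y s q) (smatch_cut P V (Suc k) k) + sum (match_wt Y s q) (\<Union>p\<in>{p \<in> P. Suc k < p}. A p)"
    unfolding split
  proof (rule sum.union_disjoint)
    show "smatch_cut P V (Suc k) k \<inter> (\<Union>p\<in>{p \<in> P. Suc k < p}. A p) = {}"
      by (fastforce simp: smatch_cut_def A_def)
  qed (use P V fin finite_smatch_cut in auto)
  also have "sum (match_wt Y s q) (\<Union>p\<in>{p \<in> P. Suc k < p}. A p) =
      (\<Sum>p\<in>{p \<in> P. Suc k < p}. sum (match_wt Y s q) (A p))"
  proof (rule sum.UNION_disjoint)
    show "\<forall>p\<in>{p \<in> P. Suc k < p}. \<forall>p'\<in>{p \<in> P. Suc k < p}. p \<noteq> p' \<longrightarrow> A p \<inter> A p' = {}"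
      using smatch_value_unique by (fastforce simp: A_def)
  qed (use P fin in auto)
  also have "\<dots> = (\<Sum>p\<in>{p \<in> P. Suc k < p}. q ^ card {j \<in> P. Suc k < j \<and> j < p} *
      sum (match_wt Y s q) (smatch_cut (P - {p}) (V - {Suc k}) (Suc k) k))"
  proof (rule sum.cong[OF refl])
    fix p assume p: "p \<in> {p \<in> P. Suc k < p}"
    have nat: "nat \<bar>int (Suc k)\<bar> = Suc k" by simp
    have "sum (match_wt Y s q) (A p) =
        (\<Sum>G\<in>smatch_cut (P - {p}) (V - {Suc k}) (Suc k) k. match_wt Y s q (insert (p, int (Suc k)) G))"
      unfolding A_def smatch_cut_def
    proof (subst sum_smatch_insert, unfold nat)
      fix G assume G: "G \<in> smatch (P - {p}) (V - {Suc k})"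
      \<comment> \<open>The value \<open>Suc k\<close> is used up, so the bounds
        \<open>Suc k\<close> and \<open>k\<close> agree on the remaining letters.\<close>
      have "x \<noteq> int (Suc k)" if "(i, x) \<in> G" for i x
        using smatch_mem[OF G that] by auto
      then show "(\<forall>(i, x)\<in>insert (p, int (Suc k)) G. Suc k < i \<longrightarrow> x \<le> int (Suc k)) \<longleftrightarrow>
          (\<forall>(i, x)\<in>G. Suc k < i \<longrightarrow> x \<le> int k)"
        by fastforce
    qed (use p V in simp_all)
    also have "\<dots> = (\<Sum>G\<in>smatch_cut (P - {p}) (V - {Suc k}) (Suc k) k.
        q ^ card {j \<in> P. Suc k < j \<and> j < p} * match_wt Y s q G)"
    proof (rule sum.cong[OF refl])
      fix G assume G: "G \<in> smatch_cut (P - {p}) (V - {Suc k}) (Suc k) k"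
      then have GM: "G \<in> smatch (P - {p}) (V - {Suc k})" by (simp add: smatch_cut_def)
      have cut: "x \<le> int k" if "(i, x) \<in> G" "Suc k < i" for i x
        using G that by (auto simp: smatch_cut_def)
      have mem: "i \<in> P" "i \<noteq> p" "nat \<bar>x\<bar> \<in> V" "\<bar>x\<bar> \<noteq> int (Suc k)" if "(i, x) \<in> G" for i x
        using smatch_mem[OF GM that] by auto
      \<comment> \<open>Only the third clause of \<open>crosses\<close> can hold; its condition on
        \<open>x\<close> is automatic, because the cut gives \<open>x \<le> int k\<close> at every
        open position.\<close>
      have "crosses (p, int (Suc k)) (i, x) \<longleftrightarrow> Suc k < i \<and> i < p" if "(i, x) \<in> G" for i x
        using p cut[OF that] mem[OF that] by (auto simp: crosses_def)
      then have "{d \<in> G. crosses (p, int (Suc k)) d} = {d \<in> G. Suc k < fst d \<and> fst d < p}"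
        by auto
      moreover have "{i \<in> P - {p}. Suc k < i \<and> i < p} = {j \<in> P. Suc k < j \<and> j < p}"
        by auto
      ultimately have 1: "card {d \<in> G. crosses (p, int (Suc k)) d} = card {j \<in> P. Suc k < j \<and> j < p}"
        using card_smatch_position[OF GM, of "\<lambda>i. Suc k < i \<and> i < p"] by simp
      have "\<not> crosses (i, x) (p, int (Suc k))" if "(i, x) \<in> G" for i x
        using p cut[OF that] mem[OF that] by (auto simp: crosses_def)
      then have 2: "{d \<in> G. crosses d (p, int (Suc k))} = {}"
        by auto
      have "(p, int (Suc k)) \<notin> G" using mem by blast
      moreover have "finite G" using finite_smatch_mem[OF GM] P by simp
      ultimately show "match_wt Y s q (insert (p, int (Suc k)) G) =
          q ^ card {j \<in> P. Suc k < j \<and> j < p} * match_wt Y s q G"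
        unfolding match_wt_insert[OF \<open>finite G\<close> \<open>(p, int (Suc k)) \<notin> G\<close>] 1 2 using p by simp
    qed
    finally show "sum (match_wt Y s q) (A p) = q ^ card {j \<in> P. Suc k < j \<and> j < p} *
      sum (match_wt Y s q) (smatch_cut (P - {p}) (V - {Suc k}) (Suc k) k)"
      by (simp add: sum_distrib_left)
  qed
  finally show ?thesis .
qed

text \<open>Treats the position \<open>Suc k\<close>: either it stays open, or its letter is an open
  value \<open>v\<close>. Then \<open>v \<ge> Suc k\<close> is a weak excedance, which gives
  \<open>Y\<close>, and the crossings are with the letters of the smaller open values.\<close>

lemma sum_smatch_cut_position:
  assumes P: "finite P" "0 \<notin> P" "Suc k \<in> P" and V: "finite V" "0 \<notin> V"
  shows "sum (match_wt Y s q) (smatch_cut P V (Suc k) k) =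
    sum (match_wt Y s q) (smatch_cut P V k k) +
    (\<Sum>v\<in>{v \<in> V. k < v}. Y * q ^ card {u \<in> V. k < u \<and> u < v} *
      sum (match_wt Y s q) (smatch_cut (P - {Suc k}) (V - {v}) k k))"
proof -
  define A where "A v = {G \<in> smatch P V. (Suc k, int v) \<in> G \<and> (\<forall>(i, x)\<in>G. Suc k < i \<longrightarrow> x \<le> int k)}" for v
  have split: "smatch_cut P V (Suc k) k = smatch_cut P V k k \<union> (\<Union>v\<in>{v \<in> V. k < v}. A v)"
  proof (intro equalityI subsetI)
    fix G assume G: "G \<in> smatch_cut P V (Suc k) k"
    show "G \<in> smatch_cut P V k k \<union> (\<Union>v\<in>{v \<in> V. k < v}. A v)"
    proof (cases "\<exists>v>k. (Suc k, int v) \<in> G")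
      case True
      then obtain v where v: "k < v" "(Suc k, int v) \<in> G" by blast
      then have "v \<in> V" using G smatch_mem[of G P V "Suc k" "int v"] by (simp add: smatch_cut_def)
      then show ?thesis using G v by (auto simp: smatch_cut_def A_def)
    next
      case False
      have "x \<le> int k" if "(i, x) \<in> G" "k < i" for i x
      proof (rule ccontr)
        assume "\<not> x \<le> int k"
        moreover from this have "i = Suc k"
          using G that by (cases "i = Suc k") (auto simp: smatch_cut_def)
        moreover have "x = int (nat x)" using \<open>\<not> x \<le> int k\<close> by simp
        moreover have "k < nat x" using \<open>\<not> x \<le> int k\<close> by linarith
        ultimately show False using False that by metis
      qed
      then show ?thesis using G by (auto simp: smatch_cut_def)
    qed
  next
    fix G assume "G \<in> smatch_cut P V k k \<union> (\<Union>v\<in>{v \<in> V. k < v}. A v)"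
    then show "G \<in> smatch_cut P V (Suc k) k"
      by (auto simp: smatch_cut_def A_def)
  qed
  have fin: "finite (A p)" for p
    using P V finite_smatch[of P V] by (simp add: A_def)
  have "sum (match_wt Y s q) (smatch_cut P V (Suc k) k) =
      sum (match_wt Y s q) (smatch_cut P V k k) + sum (match_wt Y s q) (\<Union>v\<in>{v \<in> V. k < v}. A v)"
    unfolding split
  proof (rule sum.union_disjoint)
    have "G \<notin> A v" if "G \<in> smatch_cut P V k k" "k < v" for G v
      using that by (force simp: smatch_cut_def A_def)
    then show "smatch_cut P V k k \<inter> (\<Union>v\<in>{v \<in> V. k < v}. A v) = {}"
      by blast
  qed (use P V fin finite_smatch_cut in auto)
  also have "sum (match_wt Y s q) (\<Union>v\<in>{v \<in> V. k < v}. A v) =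
      (\<Sum>v\<in>{v \<in> V. k < v}. sum (match_wt Y s q) (A v))"
  proof (rule sum.UNION_disjoint)
    show "\<forall>v\<in>{v \<in> V. k < v}. \<forall>v'\<in>{v \<in> V. k < v}. v \<noteq> v' \<longrightarrow> A v \<inter> A v' = {}"
      using smatch_position_unique by (fastforce simp: A_def)
  qed (use V fin in auto)
  also have "\<dots> = (\<Sum>v\<in>{v \<in> V. k < v}. Y * q ^ card {u \<in> V. k < u \<and> u < v} *
      sum (match_wt Y s q) (smatch_cut (P - {Suc k}) (V - {v}) k k))"
  proof (rule sum.cong[OF refl])
    fix v assume v: "v \<in> {v \<in> V. k < v}"
    have nat: "nat \<bar>int v\<bar> = v" by simp
    have "sum (match_wt Y s q) (A v) =
        (\<Sum>G\<in>smatch_cut (P - {Suc k}) (V - {v}) k k. match_wt Y s q (insert (Suc k, int v) G))"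
      unfolding A_def smatch_cut_def
    proof (subst sum_smatch_insert, unfold nat)
      fix G assume G: "G \<in> smatch (P - {Suc k}) (V - {v})"
      have "i \<noteq> Suc k" if "(i, x) \<in> G" for i x
        using smatch_mem[OF G that] by auto
      \<comment> \<open>With position \<open>Suc k\<close> removed, cutting positions at
        \<open>Suc k\<close> or at \<open>k\<close> is the same.\<close>
      then have "Suc k < i \<longleftrightarrow> k < i" if "(i, x) \<in> G" for i x
        using that[THEN \<open>\<And>x i. (i, x) \<in> G \<Longrightarrow> i \<noteq> Suc k\<close>] by linarith
      then show "(\<forall>(i, x)\<in>insert (Suc k, int v) G. Suc k < i \<longrightarrow> x \<le> int k) \<longleftrightarrow>
          (\<forall>(i, x)\<in>G. k < i \<longrightarrow> x \<le> int k)"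
        by (auto simp del: less_Suc_eq)
    qed (use v P in simp_all)
    also have "\<dots> = (\<Sum>G\<in>smatch_cut (P - {Suc k}) (V - {v}) k k.
        Y * q ^ card {u \<in> V. k < u \<and> u < v} * match_wt Y s q G)"
    proof (rule sum.cong[OF refl])
      fix G assume G: "G \<in> smatch_cut (P - {Suc k}) (V - {v}) k k"
      then have GM: "G \<in> smatch (P - {Suc k}) (V - {v})" by (simp add: smatch_cut_def)
      have cut: "x \<le> int k" if "(i, x) \<in> G" "k < i" for i x
        using G that by (auto simp: smatch_cut_def)
      have mem: "i \<in> P" "i \<noteq> Suc k" "nat \<bar>x\<bar> \<in> V" "\<bar>x\<bar> \<noteq> int v" if "(i, x) \<in> G" for i x
        using smatch_mem[OF GM that] by auto
      \<comment> \<open>A positive \<open>x > k\<close> must sit at a position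
        \<open>i \<le> k\<close> and crosses by the first clause; a negative one crosses by the
        second clause wherever it sits. Hence only the absolute value matters.\<close>
      have "crosses (i, x) (Suc k, int v) \<longleftrightarrow> k < nat \<bar>x\<bar> \<and> nat \<bar>x\<bar> < v" if "(i, x) \<in> G" for i x
        using v cut[OF that] mem[OF that] by (auto simp: crosses_def)
      then have "{d \<in> G. crosses d (Suc k, int v)} = {d \<in> G. k < nat \<bar>snd d\<bar> \<and> nat \<bar>snd d\<bar> < v}"
        by auto
      moreover have "{u \<in> V - {v}. k < u \<and> u < v} = {u \<in> V. k < u \<and> u < v}"
        by auto
      ultimately have 1: "card {d \<in> G. crosses d (Suc k, int v)} = card {u \<in> V. k < u \<and> u < v}"
        using card_smatch_value[OF GM, of "\<lambda>u. k < u \<and> u < v"] by simp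
      have "\<not> crosses (Suc k, int v) (i, x)" if "(i, x) \<in> G" for i x
        using v cut[OF that] mem[OF that] by (auto simp: crosses_def)
      then have 2: "{d \<in> G. crosses (Suc k, int v) d} = {}"
        by auto
      have "(Suc k, int v) \<notin> G" using mem by blast
      moreover have "finite G" using finite_smatch_mem[OF GM] P by simp
      ultimately show "match_wt Y s q (insert (Suc k, int v) G) =
          Y * q ^ card {u \<in> V. k < u \<and> u < v} * match_wt Y s q G"
        unfolding match_wt_insert[OF \<open>finite G\<close> \<open>(Suc k, int v) \<notin> G\<close>] 1 2 using v by simp
    qed
    finally show "sum (match_wt Y s q) (A v) = Y * q ^ card {u \<in> V. k < u \<and> u < v} *
      sum (match_wt Y s q) (smatch_cut (P - {Suc k}) (V - {v}) k k)"
      by (simp add: sum_distrib_left)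
  qed
  finally show ?thesis .
qed

text \<open>When everything is treated, all letters are negative. The letter \<open>- v\<close> of
  the last position crosses exactly the letters of larger absolute value, by the third
  clause.\<close>

lemma sum_smatch_cut_0:
  assumes P: "finite P" "0 \<notin> P" "p \<in> P" "\<And>i. i \<in> P \<Longrightarrow> i \<le> p" and V: "finite V" "0 \<notin> V"
  shows "sum (match_wt Y s q) (smatch_cut P V 0 0) =
    (\<Sum>v\<in>V. s * q ^ card {u \<in> V. v < u} *
      sum (match_wt Y s q) (smatch_cut (P - {p}) (V - {v}) 0 0))"
proof -
  define A where "A v = {G \<in> smatch P V. (p, - int v) \<in> G \<and> (\<forall>(i, x)\<in>G. 0 < i \<longrightarrow> x \<le> 0)}" for v
  have split: "smatch_cut P V 0 0 = (\<Union>v\<in>V. A v)"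
  proof (intro equalityI subsetI)
    fix G assume G: "G \<in> smatch_cut P V 0 0"
    then have GM: "G \<in> smatch P V" by (simp add: smatch_cut_def)
    from smatch_position_ex[OF GM P(3)] obtain a where a: "(p, a) \<in> G" by blast
    have "0 < p" using P by (cases p) auto
    then have "a \<le> 0" using G a by (auto simp: smatch_cut_def)
    moreover have "nat \<bar>a\<bar> \<in> V" using smatch_mem[OF GM a] by simp
    ultimately show "G \<in> (\<Union>v\<in>V. A v)" using G a
      by (intro UN_I[of "nat \<bar>a\<bar>"]) (auto simp: smatch_cut_def A_def)
  qed (auto simp: smatch_cut_def A_def)
  have "sum (match_wt Y s q) (smatch_cut P V 0 0) = (\<Sum>v\<in>V. sum (match_wt Y s q) (A v))"
    unfolding split
  proof (rule sum.UNION_disjoint)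
    show "\<forall>v\<in>V. \<forall>v'\<in>V. v \<noteq> v' \<longrightarrow> A v \<inter> A v' = {}"
      using smatch_position_unique by (fastforce simp: A_def)
    show "\<forall>v\<in>V. finite (A v)"
      using P V finite_smatch[of P V] by (simp add: A_def)
  qed (use V in auto)
  also have "\<dots> = (\<Sum>v\<in>V. s * q ^ card {u \<in> V. v < u} *
      sum (match_wt Y s q) (smatch_cut (P - {p}) (V - {v}) 0 0))"
  proof (rule sum.cong[OF refl])
    fix v assume v: "v \<in> V"
    then have "0 < v" using V by (cases v) auto
    have nat: "nat \<bar>- int v\<bar> = v" by simp
    have "sum (match_wt Y s q) (A v) =
        (\<Sum>G\<in>smatch_cut (P - {p}) (V - {v}) 0 0. match_wt Y s q (insert (p, - int v) G))"
      unfolding A_def smatch_cut_def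
      by (subst sum_smatch_insert[where R = "\<lambda>G. \<forall>(i, x)\<in>G. 0 < i \<longrightarrow> x \<le> 0"], unfold nat)
        (use v P in simp_all)
    also have "\<dots> = (\<Sum>G\<in>smatch_cut (P - {p}) (V - {v}) 0 0.
        s * q ^ card {u \<in> V. v < u} * match_wt Y s q G)"
    proof (rule sum.cong[OF refl])
      fix G assume G: "G \<in> smatch_cut (P - {p}) (V - {v}) 0 0"
      then have GM: "G \<in> smatch (P - {p}) (V - {v})" by (simp add: smatch_cut_def)
      have mem: "i \<in> P" "i \<noteq> p" "nat \<bar>x\<bar> \<in> V" "\<bar>x\<bar> \<noteq> int v" if "(i, x) \<in> G" for i x
        using smatch_mem[OF GM that] by auto
      have ip: "0 < i" "i < p" if "(i, x) \<in> G" for i x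
        using mem(1,2)[OF that] P(2) P(4)[of i] by (cases i; simp)+
      have x: "x < 0" if "(i, x) \<in> G" for i x
      proof -
        have "x \<le> 0" using G that ip[OF that] by (auto simp: smatch_cut_def)
        moreover have "x \<noteq> 0" using mem(3)[OF that] V by auto
        ultimately show ?thesis by simp
      qed
      have "crosses (p, - int v) (i, x) \<longleftrightarrow> v < nat \<bar>x\<bar>" if "(i, x) \<in> G" for i x
        using x[OF that] ip[OF that] by (auto simp: crosses_def)
      then have "{d \<in> G. crosses (p, - int v) d} = {d \<in> G. v < nat \<bar>snd d\<bar>}"
        by auto
      moreover have "{u \<in> V - {v}. v < u} = {u \<in> V. v < u}"
        by auto
      ultimately have 1: "card {d \<in> G. crosses (p, - int v) d} = card {u \<in> V. v < u}"
        using card_smatch_value[OF GM, of "\<lambda>u. v < u"] by simp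
      have "\<not> crosses (i, x) (p, - int v)" if "(i, x) \<in> G" for i x
        using x[OF that] ip[OF that] by (auto simp: crosses_def)
      then have 2: "{d \<in> G. crosses d (p, - int v)} = {}"
        by auto
      have "(p, - int v) \<notin> G" using mem by blast
      moreover have "finite G" using finite_smatch_mem[OF GM] P by simp
      ultimately show "match_wt Y s q (insert (p, - int v) G) =
          s * q ^ card {u \<in> V. v < u} * match_wt Y s q G"
        unfolding match_wt_insert[OF \<open>finite G\<close> \<open>(p, - int v) \<notin> G\<close>] 1 2 using \<open>0 < v\<close> by simp
    qed
    finally show "sum (match_wt Y s q) (A v) = s * q ^ card {u \<in> V. v < u} *
      sum (match_wt Y s q) (smatch_cut (P - {p}) (V - {v}) 0 0)"
      by (simp add: sum_distrib_left)
  qed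
  finally show ?thesis .
qed

section \<open>Iterating the recursions\<close>

lemma smatch_empty: "smatch {} {} = {{}}"
  by (auto simp: smatch_def bij_betw_def)

text \<open>Removing the last position repeatedly yields the factors \<open>s * qint q h\<close>,
  \<open>s * qint q (h - 1)\<close> and so on.\<close>

lemma sum_smatch_neg:
  assumes "finite P" "finite V" "0 \<notin> P" "0 \<notin> V" "card P = h" "card V = h"
  shows "sum (match_wt Y s q) (smatch_cut P V 0 0) = neg_wt s q h"
  using assms
proof (induction h arbitrary: P V)
  case 0
  then have "P = {}" "V = {}" by simp_all
  then have "smatch_cut P V 0 0 = {{}}"
    unfolding smatch_cut_def by (auto simp: smatch_empty)
  then show ?case by (simp add: match_wt_def neg_wt_def)
next
  case (Suc h)
  note prems = Suc.prems
  have "P \<noteq> {}" using prems(5) by force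
  have P: "Max P \<in> P" by (rule Max_in[OF prems(1) \<open>P \<noteq> {}\<close>])
  have cP: "card (P - {Max P}) = h"
    using card_Diff_singleton[OF P] prems(5) by linarith
  have IH: "sum (match_wt Y s q) (smatch_cut (P - {Max P}) (V - {v}) 0 0) = neg_wt s q h"
    if "v \<in> V" for v
  proof (rule Suc.IH)
    show "card (V - {v}) = h"
      using card_Diff_singleton[OF that] prems(6) by linarith
  qed (use prems(1-4) cP in blast)+
  have "sum (match_wt Y s q) (smatch_cut P V 0 0) =
    (\<Sum>v\<in>V. s * q ^ card {u \<in> V. v < u} * sum (match_wt Y s q) (smatch_cut (P - {Max P}) (V - {v}) 0 0))"
    by (rule sum_smatch_cut_0[OF prems(1,3) P Max_ge[OF prems(1)] prems(2,4)])
  also have "\<dots> = (\<Sum>v\<in>V. s * q ^ card {u \<in> V. v < u} * neg_wt s q h)"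
    by (intro sum.cong refl arg_cong2[where f = "(*)"] IH)
  also have "\<dots> = s * (\<Sum>v\<in>V. q ^ card {u \<in> V. v < u}) * neg_wt s q h"
    unfolding sum_distrib_left sum_distrib_right ..
  also have "(\<Sum>v\<in>V. q ^ card {u \<in> V. v < u}) = qint q (Suc h)"
    using sum_power_corank[OF prems(2)] unfolding prems(6) .
  also have "s * qint q (Suc h) * neg_wt s q h = neg_wt s q (Suc h)"
    by (simp add: neg_wt_def mult_ac)
  finally show ?case .
qed

text \<open>One application of \<open>opM\<close> accounts for the value and the position
  \<open>Suc k\<close>. Its argument \<open>h\<close> counts the open positions, which are as many
  as the open values.\<close>

lemma sum_smatch_cut:
  assumes "finite P" "finite V" "0 \<notin> P" "0 \<notin> V" "{1..k} \<subseteq> P" "{1..k} \<subseteq> V"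
    and "card {i \<in> P. k < i} = h" "card {v \<in> V. k < v} = h"
  shows "sum (match_wt Y s q) (smatch_cut P V k k) = (opM Y q ^^ k) (neg_wt s q) h"
  using assms
proof (induction k arbitrary: P V h)
  case 0
  have pos: "{i \<in> A. 0 < i} = A" if "0 \<notin> A" for A :: "nat set"
  proof (intro equalityI subsetI CollectI conjI)
    show "0 < i" if "i \<in> A" for i
      using that \<open>0 \<notin> A\<close> by (cases i) simp_all
  qed simp_all
  have "card P = h" "card V = h"
    using 0(7,8) unfolding pos[OF 0(3)] pos[OF 0(4)] .
  from sum_smatch_neg[OF 0(1-4) this] show ?case by simp
next
  case (Suc k)
  let ?W = "\<lambda>P V a b. sum (match_wt Y s q) (smatch_cut P V a b)"
  let ?f = "(opM Y q ^^ k) (neg_wt s q)"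
  \<comment> \<open>The state between the two half steps: the value \<open>Suc k\<close> is treated
    but the position is not, so there is one more open value than open positions. It is used below
    with and without a match of the value.\<close>
  have half: "?W P V (Suc k) k = ?f (Suc h) + Y * qint q (Suc h) * ?f h"
    if P: "finite P" "0 \<notin> P" "{1..Suc k} \<subseteq> P" "card {i \<in> P. Suc k < i} = h"
      and V: "finite V" "0 \<notin> V" "{1..k} \<subseteq> V" "card {v \<in> V. k < v} = Suc h" for P V h
  proof -
    have in_P: "Suc k \<in> P" using P(3) by auto
    have sub: "{1..k} \<subseteq> P" "{1..k} \<subseteq> P - {Suc k}" using P(3) by auto
    have sub': "{1..k} \<subseteq> V - {v}" if "k < v" for v using V(3) that by auto
    from in_P have eq: "{i \<in> P. k < i} = insert (Suc k) {i \<in> P. Suc k < i}"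
      by auto
    have cP: "card {i \<in> P. k < i} = Suc h"
      unfolding eq using P(1,4) by simp
    have "?W P V (Suc k) k = ?W P V k k +
      (\<Sum>v\<in>{v \<in> V. k < v}. Y * q ^ card {u \<in> V. k < u \<and> u < v} * ?W (P - {Suc k}) (V - {v}) k k)"
      by (rule sum_smatch_cut_position[OF P(1,2) in_P V(1,2)])
    also have "?W P V k k = ?f (Suc h)"
      by (rule Suc.IH[OF P(1) V(1) P(2) V(2) sub(1) V(3) cP V(4)])
    also have "(\<Sum>v\<in>{v \<in> V. k < v}. Y * q ^ card {u \<in> V. k < u \<and> u < v} * ?W (P - {Suc k}) (V - {v}) k k) =
        (\<Sum>v\<in>{v \<in> V. k < v}. Y * q ^ card {u \<in> V. k < u \<and> u < v} * ?f h)"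
    proof (intro sum.cong arg_cong2[where f = "(*)"] Suc.IH refl)
      fix v assume v: "v \<in> {v \<in> V. k < v}"
      have "{i \<in> P - {Suc k}. k < i} = {i \<in> P. Suc k < i}" by auto
      then show "card {i \<in> P - {Suc k}. k < i} = h" using P(4) by simp
      have "{u \<in> V - {v}. k < u} = {u \<in> V. k < u} - {v}" by auto
      then show "card {u \<in> V - {v}. k < u} = h" using V v by simp
      show "{1..k} \<subseteq> V - {v}" using sub' v by blast
    qed (use P(1,2) V(1,2) sub in simp_all)
    also have "\<dots> = Y * (\<Sum>v\<in>{v \<in> V. k < v}. q ^ card {u \<in> {v \<in> V. k < v}. u < v}) * ?f h"
      unfolding sum_distrib_left sum_distrib_right by simp
    also have "\<dots> = Y * qint q (Suc h) * ?f h"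
      using sum_power_rank[of "{v \<in> V. k < v}" q] V(1,4) by simp
    finally show ?thesis .
  qed
  note prems = Suc.prems
  have in_V: "Suc k \<in> V" using prems(6) by auto
  have sub: "{1..k} \<subseteq> V" "{1..k} \<subseteq> V - {Suc k}" using prems(6) by auto
  have sub': "{1..Suc k} \<subseteq> P - {p}" if "Suc k < p" for p using prems(5) that by auto
  from in_V have eq: "{i \<in> V. k < i} = insert (Suc k) {i \<in> V. Suc k < i}"
    by auto
  have cV: "card {i \<in> V. k < i} = Suc h"
    unfolding eq using prems(2,8) by simp
  have "?W P V (Suc k) (Suc k) = ?W P V (Suc k) k +
      (\<Sum>p\<in>{p \<in> P. Suc k < p}. q ^ card {j \<in> P. Suc k < j \<and> j < p} * ?W (P - {p}) (V - {Suc k}) (Suc k) k)"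
    by (rule sum_smatch_cut_value[OF prems(1,3,2,4) in_V])
  also have "?W P V (Suc k) k = ?f (Suc h) + Y * qint q (Suc h) * ?f h"
    by (rule half[OF prems(1,3,5,7) prems(2,4) sub(1) cV])
  also have "(\<Sum>p\<in>{p \<in> P. Suc k < p}. q ^ card {j \<in> P. Suc k < j \<and> j < p} * ?W (P - {p}) (V - {Suc k}) (Suc k) k) =
      (\<Sum>p\<in>{p \<in> P. Suc k < p}. q ^ card {j \<in> P. Suc k < j \<and> j < p} * (?f h + Y * qint q h * ?f (h - 1)))"
  proof (intro sum.cong arg_cong2[where f = "(*)"] refl)
    fix p assume p: "p \<in> {p \<in> P. Suc k < p}"
    \<comment> \<open>An open position \<open>p\<close> exists, so \<open>h - 1\<close> is not
      truncated.\<close>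
    then have "0 < h" using prems(1) card_gt_0_iff[of "{p \<in> P. Suc k < p}"]
      unfolding prems(7) by auto
    then obtain h' where h: "h = Suc h'" by (cases h) auto
    have "?W (P - {p}) (V - {Suc k}) (Suc k) k = ?f (Suc h') + Y * qint q (Suc h') * ?f h'"
    proof (rule half)
      have "{i \<in> P - {p}. Suc k < i} = {i \<in> P. Suc k < i} - {p}" by auto
      then show "card {i \<in> P - {p}. Suc k < i} = h'" using prems(1,7) p h by simp
      have "{v \<in> V - {Suc k}. k < v} = {v \<in> V. Suc k < v}" by auto
      then show "card {v \<in> V - {Suc k}. k < v} = Suc h'" using prems(8) h by simp
      show "{1..Suc k} \<subseteq> P - {p}" using sub' p by blast
    qed (use prems(1-4) sub in simp_all)
    then show "?W (P - {p}) (V - {Suc k}) (Suc k) k = ?f h + Y * qint q h * ?f (h - 1)"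
      by (simp add: h)
  qed
  also have "\<dots> = (\<Sum>p\<in>{p \<in> P. Suc k < p}. q ^ card {j \<in> {p \<in> P. Suc k < p}. j < p}) *
      (?f h + Y * qint q h * ?f (h - 1))"
    unfolding sum_distrib_right by simp
  also have "\<dots> = qint q h * (?f h + Y * qint q h * ?f (h - 1))"
    using sum_power_rank[of "{p \<in> P. Suc k < p}" q] prems(1,7) by simp
  finally show ?case
    by (simp only: funpow.simps o_apply opM_apply[of Y q ?f])
qed

section \<open>Signed permutations as graphs\<close>

definition word_graph :: "int list \<Rightarrow> (nat \<times> int) set" where
  "word_graph w = (\<lambda>i. (i, sp_letter w i)) ` {1..length w}"

definition graph_word :: "nat \<Rightarrow> (nat \<times> int) set \<Rightarrow> int list" where
  "graph_word n G = map (\<lambda>i. THE a. (Suc i, a) \<in> G) [0..<n]"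

lemma word_graph_iff: "(i, a) \<in> word_graph w \<longleftrightarrow> i \<in> {1..length w} \<and> a = sp_letter w i"
  by (auto simp: word_graph_def)

lemma word_graph_smatch:
  assumes w: "w \<in> signed_perms n"
  shows "word_graph w \<in> smatch {1..n} {1..n}"
proof -
  have len: "length w = n" by (rule length_signed_perms[OF w])
  have abs_w: "abs ` set w = {1..int n}" "distinct (map abs w)"
    using w by (simp_all add: signed_perms_def permutations_of_set_def)
  have "bij_betw fst (word_graph w) {1..n}"
    by (auto simp: word_graph_def len bij_betw_def inj_on_def image_image)
  moreover have "bij_betw (\<lambda>c. nat \<bar>snd c\<bar>) (word_graph w) {1..n}"
  proof (rule bij_betw_imageI)
    have "i = j" if "i \<in> {1..n}" "j \<in> {1..n}" "nat \<bar>sp_letter w i\<bar> = nat \<bar>sp_letter w j\<bar>" for i j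
    proof -
      have lt: "i - 1 < length (map abs w)" "j - 1 < length (map abs w)"
        using that len by auto
      moreover have "map abs w ! (i - 1) = map abs w ! (j - 1)"
        using lt that(3) by (simp add: sp_letter_def eq_nat_nat_iff)
      ultimately have "i - 1 = j - 1" using nth_eq_iff_index_eq[OF abs_w(2)] by blast
      then show ?thesis using that by auto
    qed
    note unique = this
    show "inj_on (\<lambda>c. nat \<bar>snd c\<bar>) (word_graph w)"
    proof (rule inj_onI)
      fix c d assume "c \<in> word_graph w" "d \<in> word_graph w" and eq: "nat \<bar>snd c\<bar> = nat \<bar>snd d\<bar>"
      then obtain i j where "i \<in> {1..n}" "j \<in> {1..n}" "c = (i, sp_letter w i)" "d = (j, sp_letter w j)"
        unfolding word_graph_def len by blast
      with eq unique[of i j] show "c = d" by simp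
    qed
    \<comment> \<open>Positions start at 1 and list indices at 0, hence the shift.\<close>
    have "(\<lambda>c. nat \<bar>snd c\<bar>) ` word_graph w = (\<lambda>i. nat \<bar>w ! i\<bar>) ` ((\<lambda>i. i - 1) ` {1..n})"
      by (simp add: word_graph_def len image_image sp_letter_def)
    also have "(\<lambda>i. i - 1) ` {1..n} = {..<n}"
    proof (intro equalityI subsetI)
      show "i \<in> (\<lambda>i. i - 1) ` {1..n}" if "i \<in> {..<n}" for i
        using that by (intro image_eqI[of _ _ "Suc i"]) auto
    qed auto
    also have "(\<lambda>i. nat \<bar>w ! i\<bar>) ` {..<n} = nat ` abs ` set w"
      by (auto simp: set_conv_nth len image_iff)
    also have "\<dots> = {1..n}"
    proof (unfold abs_w, intro equalityI subsetI)
      show "i \<in> nat ` {1..int n}" if "i \<in> {1..n}" for i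
        using that by (intro image_eqI[of _ _ "int i"]) auto
    qed auto
    finally show "(\<lambda>c. nat \<bar>snd c\<bar>) ` word_graph w = {1..n}" .
  qed
  ultimately show ?thesis by (simp add: smatch_def)
qed

lemma smatch_the:
  assumes "G \<in> smatch P V" "i \<in> P"
  shows "(i, a) \<in> G \<longleftrightarrow> a = (THE a. (i, a) \<in> G)"
proof -
  obtain b where b: "(i, b) \<in> G" using smatch_position_ex[OF assms] by blast
  then have "(THE a. (i, a) \<in> G) = b"
    using smatch_position_unique[OF assms(1)] by (intro the_equality) auto
  then show ?thesis using b smatch_position_unique[OF assms(1)] by auto
qed

lemma sp_letter_graph_word:
  "i \<in> {1..n} \<Longrightarrow> sp_letter (graph_word n G) i = (THE a. (i, a) \<in> G)"
  by (auto simp: sp_letter_def graph_word_def)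

lemma length_graph_word: "length (graph_word n G) = n"
  by (simp add: graph_word_def)

lemma word_graph_graph_word:
  assumes "G \<in> smatch {1..n} {1..n}"
  shows "word_graph (graph_word n G) = G"
proof -
  have "(i, a) \<in> word_graph (graph_word n G) \<longleftrightarrow> (i, a) \<in> G" for i a
  proof (cases "i \<in> {1..n}")
    case True
    then show ?thesis
      unfolding word_graph_iff length_graph_word sp_letter_graph_word[OF True]
        smatch_the[OF assms True, of a] by simp
  next
    case False
    then show ?thesis using smatch_mem[OF assms, of i a]
      unfolding word_graph_iff length_graph_word by blast
  qed
  then show ?thesis by (simp add: set_eq_iff split_paired_all)
qed

lemma graph_word_word_graph:
  assumes "length w = n"
  shows "graph_word n (word_graph w) = w"
  using assms by (intro nth_equalityI) (auto simp: graph_word_def word_graph_iff sp_letter_def)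

lemma graph_word_signed_perms:
  assumes G: "G \<in> smatch {1..n} {1..n}"
  shows "graph_word n G \<in> signed_perms n"
proof -
  let ?w = "graph_word n G"
  note len = length_graph_word[of n G]
  have mem: "(Suc i, ?w ! i) \<in> G" if "i < n" for i
  proof -
    have "(Suc i, THE a. (Suc i, a) \<in> G) \<in> G"
      using smatch_the[OF G, THEN iffD2, OF _ refl, of "Suc i"] that by simp
    then show ?thesis using that by (simp add: graph_word_def)
  qed
  have dist: "distinct (map abs ?w)"
    unfolding distinct_conv_nth
  proof (intro allI impI notI)
    fix i j assume "i < length (map abs ?w)" "j < length (map abs ?w)" "i \<noteq> j"
      and eq: "map abs ?w ! i = map abs ?w ! j"
    then have ij: "i < n" "j < n" "Suc i \<noteq> Suc j" by (simp_all add: len)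
    then have "\<bar>?w ! i\<bar> = \<bar>?w ! j\<bar>" using eq by (simp add: len)
    with smatch_value_unique[OF G mem[OF ij(1)] mem[OF ij(2)]] ij(3) show False by blast
  qed
  have "set (map abs ?w) \<subseteq> {1..int n}"
  proof
    fix x assume "x \<in> set (map abs ?w)"
    then obtain i where i: "i < n" "x = \<bar>?w ! i\<bar>" by (auto simp: set_conv_nth len)
    then have "nat x \<in> {1..n}" using smatch_mem[OF G mem[OF i(1)]] by blast
    then have "1 \<le> nat x" "nat x \<le> n" by simp_all
    then have "1 \<le> x" "x \<le> int n" by linarith+
    then show "x \<in> {1..int n}" by simp
  qed
  moreover have "card (set (map abs ?w)) = card {1..int n}"
    unfolding distinct_card[OF dist] length_map len by simp
  ultimately have "set (map abs ?w) = {1..int n}"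
    by (intro card_subset_eq finite_atLeastAtMost_int)
  then show ?thesis using dist by (simp add: signed_perms_def permutations_of_set_def)
qed

lemma bij_betw_word_graph: "bij_betw word_graph (signed_perms n) (smatch {1..n} {1..n})"
proof (rule bij_betw_byWitness[of _ "graph_word n"])
  show "\<forall>w\<in>signed_perms n. graph_word n (word_graph w) = w"
    using graph_word_word_graph length_signed_perms by blast
  show "\<forall>G\<in>smatch {1..n} {1..n}. word_graph (graph_word n G) = G"
    using word_graph_graph_word by blast
qed (use word_graph_smatch graph_word_signed_perms in blast)+

lemma match_wt_word_graph:
  "match_wt Y s q (word_graph w) = Y ^ sp_wex w * s ^ sp_neg w * q ^ sp_cro w"
proof -
  let ?e = "\<lambda>i. (i, sp_letter w i)"
  have inj: "inj_on ?e A" for A by (auto simp: inj_on_def)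
  have "{(i, a) \<in> word_graph w. int i \<le> a} = ?e ` {i \<in> {1..length w}. sp_letter w i \<ge> int i}"
    by (auto simp: word_graph_iff)
  then have 1: "card {(i, a) \<in> word_graph w. int i \<le> a} = sp_wex w"
    by (simp add: card_image inj sp_wex_def)
  have "{(i, a) \<in> word_graph w. a < 0} = ?e ` {i \<in> {1..length w}. sp_letter w i < 0}"
    by (auto simp: word_graph_iff)
  then have 2: "card {(i, a) \<in> word_graph w. a < 0} = sp_neg w"
    by (simp add: card_image inj sp_neg_def)
  have "{(c, d) \<in> word_graph w \<times> word_graph w. crosses c d} =
      (\<lambda>(i, j). (?e i, ?e j)) ` {(i, j). i \<in> {1..length w} \<and> j \<in> {1..length w} \<and> is_crossing w i j}"
  proof (intro equalityI subsetI)
    fix z assume "z \<in> {(c, d) \<in> word_graph w \<times> word_graph w. crosses c d}"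
    then obtain i j where "i \<in> {1..length w}" "j \<in> {1..length w}" "z = (?e i, ?e j)"
      "crosses (?e i) (?e j)"
      by (auto simp: word_graph_iff)
    then show "z \<in> (\<lambda>(i, j). (?e i, ?e j)) `
        {(i, j). i \<in> {1..length w} \<and> j \<in> {1..length w} \<and> is_crossing w i j}"
      by (intro image_eqI[of _ _ "(i, j)"]) (simp_all add: crosses_def is_crossing_def)
  qed (auto simp: word_graph_iff crosses_def is_crossing_def)
  moreover have "inj_on (\<lambda>(i, j). (?e i, ?e j)) A" for A
    by (auto simp: inj_on_def)
  ultimately have 3: "card {(c, d) \<in> word_graph w \<times> word_graph w. crosses c d} = sp_cro w"
    by (simp add: card_image sp_cro_def)
  show ?thesis unfolding match_wt_def 1 2 3 ..
qed

lemma sum_signed_perms: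
  "(\<Sum>w\<in>signed_perms n. Y ^ sp_wex w * s ^ sp_neg w * q ^ sp_cro w) = (opM Y q ^^ n) (neg_wt s q) 0"
proof -
  have "(\<Sum>w\<in>signed_perms n. Y ^ sp_wex w * s ^ sp_neg w * q ^ sp_cro w) =
      sum (match_wt Y s q) (smatch {1..n} {1..n})"
    unfolding sum.reindex_bij_betw[OF bij_betw_word_graph, symmetric] match_wt_word_graph ..
  \<comment> \<open>No position exceeds \<open>n\<close>, so this cut is vacuous and nothing is
    open: \<open>h = 0\<close>.\<close>
  also have "smatch {1..n} {1..n} = smatch_cut {1..n} {1..n} n n"
  proof -
    have "i \<le> n" if "G \<in> smatch {1..n} {1..n}" "(i, x) \<in> G" for G i x
      using smatch_mem[OF that] by simp
    then show ?thesis unfolding smatch_cut_def by (auto simp: not_less[symmetric])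
  qed
  also have "sum (match_wt Y s q) \<dots> = (opM Y q ^^ n) (neg_wt s q) 0"
    by (rule sum_smatch_cut) auto
  finally show ?thesis .
qed

section \<open>Permutation tableaux\<close>

definition ptab :: "ferrers \<Rightarrow> (nat \<times> nat) set \<Rightarrow> bool" where
  "ptab F X \<longleftrightarrow> is_ferrers F \<and> X \<subseteq> shifted_cells F \<and> (\<forall>j<snd F. \<exists>i. (i, j) \<in> X) \<and>
     (\<forall>i j. (i, j) \<in> shifted_cells F - X \<longrightarrow> \<not> ((\<exists>i'<i. (i', j) \<in> X) \<and> (\<exists>j'<j. (i, j') \<in> X))) \<and>
     (\<forall>j<snd F. (j, j) \<notin> X \<longrightarrow> \<not> (\<exists>j'<j. (j, j') \<in> X))"

text \<open>The rows in which a column added on the left may have a one.\<close>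

definition open_rows :: "ferrers \<Rightarrow> (nat \<times> nat) set \<Rightarrow> nat set" where
  "open_rows F X = {i. i < ferrers_length F \<and>
     (\<forall>j. (i, j) \<in> shifted_cells F - X \<longrightarrow> \<not> (\<exists>i'<i. (i', j) \<in> X)) \<and> (i < snd F \<longrightarrow> (i, i) \<in> X)}"

definition superfluous :: "(nat \<times> nat) set \<Rightarrow> (nat \<times> nat) set" where
  "superfluous X = {(i, j). (i, j) \<in> X \<and> (\<exists>i'<i. (i', j) \<in> X)}"

definition diag_ones :: "ferrers \<Rightarrow> (nat \<times> nat) set \<Rightarrow> nat set" where
  "diag_ones F X = {j. j < snd F \<and> (j, j) \<in> X}"

definition ptab_wt :: "'a::comm_ring_1 \<Rightarrow> 'a \<Rightarrow> 'a \<Rightarrow> ferrers \<Rightarrow> (nat \<times> nat) set \<Rightarrow> 'a" where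
  "ptab_wt Y s q F X = Y ^ length (fst F) * s ^ card (diag_ones F X) * q ^ card (superfluous X)"

section \<open>Growth of a diagram by an empty row or a leftmost column\<close>

definition add_row :: "ferrers \<Rightarrow> ferrers" where
  "add_row F = (fst F @ [0], snd F)"

text \<open>The diagonal cell of the new leftmost column is a new top row of length 1. Every old
  cell therefore moves by one in both coordinates, which explains \<open>map_prod Suc Suc\<close> in
  \<open>col_ones\<close>.\<close>

definition add_col :: "ferrers \<Rightarrow> ferrers" where
  "add_col F = (map Suc (fst F), Suc (snd F))"

definition col_ones :: "(nat \<times> nat) set \<Rightarrow> nat set \<Rightarrow> (nat \<times> nat) set" where
  "col_ones X C = map_prod Suc Suc ` X \<union> C \<times> {0}"

lemma col_ones_iff [simp]:
  "(i, 0) \<in> col_ones X C \<longleftrightarrow> i \<in> C"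
  "(0, Suc j) \<notin> col_ones X C"
  "(Suc i, Suc j) \<in> col_ones X C \<longleftrightarrow> (i, j) \<in> X"
  by (auto simp: col_ones_def)

lemma finite_open_rows: "finite (open_rows F X)"
  by (rule finite_subset[of _ "{..<ferrers_length F}"]) (auto simp: open_rows_def)

lemma ferrers_length_add [simp]:
  "ferrers_length (add_row F) = Suc (ferrers_length F)"
  "ferrers_length (add_col F) = Suc (ferrers_length F)"
  by (simp_all add: ferrers_length_def add_row_def add_col_def)

lemma length_shifted_rows: "length (shifted_rows F) = ferrers_length F"
  by (simp add: shifted_rows_def ferrers_length_def)

lemma shifted_cells_row_bound: "(i, j) \<in> shifted_cells F \<Longrightarrow> i < ferrers_length F"
  by (simp add: shifted_cells_def length_shifted_rows)

lemma shifted_rows_add_row: "shifted_rows (add_row F) = shifted_rows F @ [0]"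
  by (simp add: shifted_rows_def add_row_def)

lemma shifted_rows_add_col: "shifted_rows (add_col F) = 1 # map Suc (shifted_rows F)"
proof -
  have "[1..<Suc (Suc (snd F))] = 1 # map Suc [1..<Suc (snd F)]"
    by (simp add: map_Suc_upt upt_conv_Cons del: upt_Suc)
  then show ?thesis by (simp add: shifted_rows_def add_col_def del: upt_Suc)
qed

lemma shifted_cells_add_row: "shifted_cells (add_row F) = shifted_cells F"
  unfolding shifted_cells_def shifted_rows_add_row
  by (auto simp: nth_append less_Suc_eq split: if_splits)

lemma shifted_cells_add_col_iff [simp]:
  "(i, 0) \<in> shifted_cells (add_col F) \<longleftrightarrow> i \<le> ferrers_length F"
  "(0, Suc j) \<notin> shifted_cells (add_col F)"
  "(Suc i, Suc j) \<in> shifted_cells (add_col F) \<longleftrightarrow> (i, j) \<in> shifted_cells F"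
proof -
  show "(i, 0) \<in> shifted_cells (add_col F) \<longleftrightarrow> i \<le> ferrers_length F"
    unfolding shifted_cells_def shifted_rows_add_col
    by (cases i) (auto simp: length_shifted_rows)
qed (auto simp: shifted_cells_def shifted_rows_add_col)

lemma is_ferrers_add_row: "is_ferrers (add_row F) \<longleftrightarrow> is_ferrers F"
  by (auto simp: is_ferrers_def add_row_def sorted_wrt_append)

lemma is_ferrers_add_col: "is_ferrers (add_col F) \<longleftrightarrow> is_ferrers F"
  by (simp add: is_ferrers_def add_col_def sorted_wrt_map)

lemma add_row_neq_add_col: "add_row F \<noteq> add_col G"
proof
  assume "add_row F = add_col G"
  then have "0 \<in> set (map Suc (fst G))"
    unfolding add_row_def add_col_def by (metis in_set_conv_decomp prod.inject)
  then show False by auto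
qed

lemma inj_add_row: "add_row F = add_row G \<Longrightarrow> F = G"
  by (auto simp: add_row_def prod_eq_iff)

lemma inj_add_col: "add_col F = add_col G \<Longrightarrow> F = G"
  by (auto simp: add_col_def prod_eq_iff dest: map_injective)

lemma col_ones_inject: "col_ones X C = col_ones X' C' \<Longrightarrow> X = X' \<and> C = C'"
proof -
  assume eq: "col_ones X C = col_ones X' C'"
  have "(i, j) \<in> X \<longleftrightarrow> (i, j) \<in> X'" for i j
    using col_ones_iff(3)[of i j X C] col_ones_iff(3)[of i j X' C'] eq by simp
  moreover have "i \<in> C \<longleftrightarrow> i \<in> C'" for i
    using col_ones_iff(1)[of i X C] col_ones_iff(1)[of i X' C'] eq by simp
  ultimately show "X = X' \<and> C = C'" by auto
qed

text \<open>Row lengths decrease weakly, so a row of length 0, if any, is the last one. If there is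
  none, every row meets the first column, which can be removed.\<close>

lemma ferrers_cases:
  assumes "is_ferrers F" "ferrers_length F = Suc n"
  obtains G where "F = add_row G" | G where "F = add_col G"
proof -
  obtain l k where F: "F = (l, k)" by (cases F)
  show thesis
  proof (cases "0 \<in> set l")
    case True
    then have "l \<noteq> []" by auto
    then have l: "l = butlast l @ [last l]" by simp
    then have "\<forall>x\<in>set (butlast l). last l \<le> x"
      using assms(1) unfolding F is_ferrers_def by (metis fst_conv list.set_intros(1) sorted_wrt_append)
    moreover have "0 \<in> set (butlast l) \<or> last l = 0"
      using True \<open>l \<noteq> []\<close> by (metis l append_butlast_last_id in_set_butlast_appendI in_set_conv_decomp rotate1.simps(2) set_ConsD set_rotate1)
    ultimately have "last l = 0" by auto
    then have "F = add_row (butlast l, k)"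
      using l by (simp add: F add_row_def)
    then show thesis by (rule that(1))
  next
    case False
    then have "Suc (x - 1) = x" if "x \<in> set l" for x
      using that by (cases x) auto
    then have "map Suc (map (\<lambda>x. x - 1) l) = l"
      by (simp add: map_idI)
    \<comment> \<open>Without columns all rows would be empty, and there is at least one row since
      the length is positive.\<close>
    moreover have "k \<noteq> 0"
    proof
      assume "k = 0"
      then have "l \<noteq> []" using assms(2) by (auto simp: F ferrers_length_def)
      then have "hd l \<in> set l" by simp
      then have "hd l = 0" using assms(1) \<open>k = 0\<close> by (simp add: F is_ferrers_def)
      then show False using False \<open>hd l \<in> set l\<close> by simp
    qed
    ultimately have "F = add_col (map (\<lambda>x. x - 1) l, k - 1)"
      by (simp add: F add_col_def)
    then show thesis by (rule that(2))
  qed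
qed

section \<open>Effect of a new column on rules, open rows and statistics\<close>

lemma above_col_ones: "(\<exists>i'<Suc i. (i', Suc j) \<in> col_ones X C) \<longleftrightarrow> (\<exists>i'<i. (i', j) \<in> X)"
  by (simp add: Ex_less_Suc2)

lemma left_col_ones: "(\<exists>j'<Suc j. (Suc i, j') \<in> col_ones X C) \<longleftrightarrow> Suc i \<in> C \<or> (\<exists>j'<j. (i, j') \<in> X)"
  by (simp add: Ex_less_Suc2)

lemma all_nat_cases: "(\<forall>n. P n) \<longleftrightarrow> P 0 \<and> (\<forall>n. P (Suc n))"
  by (metis nat.exhaust)

lemma ex_nat_cases: "(\<exists>n. P n) \<longleftrightarrow> P 0 \<or> (\<exists>n. P (Suc n))"
  by (metis nat.exhaust)

lemma subset_Suc_image_iff: "C \<subseteq> insert 0 (Suc ` U) \<longleftrightarrow> (\<forall>i. Suc i \<in> C \<longrightarrow> i \<in> U)"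
proof
  show "C \<subseteq> insert 0 (Suc ` U) \<Longrightarrow> \<forall>i. Suc i \<in> C \<longrightarrow> i \<in> U" by auto
  assume U: "\<forall>i. Suc i \<in> C \<longrightarrow> i \<in> U"
  show "C \<subseteq> insert 0 (Suc ` U)"
  proof
    fix i assume "i \<in> C"
    then show "i \<in> insert 0 (Suc ` U)" using U by (cases i) auto
  qed
qed

lemma ptab_add_row: "ptab (add_row F) X \<longleftrightarrow> ptab F X"
  unfolding ptab_def is_ferrers_add_row shifted_cells_add_row by (simp add: add_row_def)

lemma col_ones_subset_iff:
  "col_ones X C \<subseteq> shifted_cells (add_col F) \<longleftrightarrow> X \<subseteq> shifted_cells F \<and> (\<forall>i\<in>C. i \<le> ferrers_length F)"
  unfolding col_ones_def Un_subset_iff by (fastforce simp: image_subset_iff)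

text \<open>The new column has nothing to its left, so the rules restrict it only through the old
  cells: a one in row \<open>Suc i\<close> now lies to the left of all of old row \<open>i\<close>.
  This is allowed exactly if that row is open. The new top row has no further cell and is always
  available.\<close>

lemma ptab_add_col:
  "ptab (add_col F) (col_ones X C) \<longleftrightarrow> ptab F X \<and> C \<noteq> {} \<and> C \<subseteq> insert 0 (Suc ` open_rows F X)"
proof -
  have snd: "snd (add_col F) = Suc (snd F)" by (simp add: add_col_def)
  have cols: "(\<forall>j<Suc (snd F). \<exists>i. (i, j) \<in> col_ones X C) \<longleftrightarrow>
      C \<noteq> {} \<and> (\<forall>j<snd F. \<exists>i. (i, j) \<in> X)"
    unfolding All_less_Suc2 using ex_nat_cases[of "\<lambda>i. (i, Suc _) \<in> col_ones X C"] by auto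
  \<comment> \<open>\<open>S\<close> stands for a one on the left in the new column,
    \<open>L\<close> for one in an old column.\<close>
  have split_all: "(\<forall>i j. P i j \<longrightarrow> \<not> (A i j \<and> (S i \<or> L i j))) \<longleftrightarrow>
      (\<forall>i j. P i j \<longrightarrow> \<not> (A i j \<and> L i j)) \<and> (\<forall>i. S i \<longrightarrow> (\<forall>j. P i j \<longrightarrow> \<not> A i j))"
    for P A L :: "nat \<Rightarrow> nat \<Rightarrow> bool" and S
    by blast
  have split_bounded: "(\<forall>j<n. P j \<longrightarrow> \<not> (S j \<or> L j)) \<longleftrightarrow>
      (\<forall>j<n. P j \<longrightarrow> \<not> L j) \<and> (\<forall>j. S j \<longrightarrow> j < n \<longrightarrow> \<not> P j)"
    for P S L :: "nat \<Rightarrow> bool" and n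
    by blast
  have rule2: "(\<forall>i j. (i, j) \<in> shifted_cells (add_col F) - col_ones X C \<longrightarrow>
        \<not> ((\<exists>i'<i. (i', j) \<in> col_ones X C) \<and> (\<exists>j'<j. (i, j') \<in> col_ones X C))) \<longleftrightarrow>
      (\<forall>i j. (i, j) \<in> shifted_cells F - X \<longrightarrow> \<not> ((\<exists>i'<i. (i', j) \<in> X) \<and> (\<exists>j'<j. (i, j') \<in> X))) \<and>
      (\<forall>i. Suc i \<in> C \<longrightarrow> (\<forall>j. (i, j) \<in> shifted_cells F - X \<longrightarrow> \<not> (\<exists>i'<i. (i', j) \<in> X)))"
    (is "?L \<longleftrightarrow> ?R")
  proof -
    \<comment> \<open>Cells of column 0 have nothing to their left, and row 0 has no cell outside
      column 0.\<close>
    have "?L \<longleftrightarrow> (\<forall>i j. (Suc i, Suc j) \<in> shifted_cells (add_col F) - col_ones X C \<longrightarrow>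
        \<not> ((\<exists>i'<Suc i. (i', Suc j) \<in> col_ones X C) \<and> (\<exists>j'<Suc j. (Suc i, j') \<in> col_ones X C)))"
      (is "_ \<longleftrightarrow> ?M")
    proof
      assume M: ?M
      show ?L
      proof (intro allI)
        fix i j
        show "(i, j) \<in> shifted_cells (add_col F) - col_ones X C \<longrightarrow>
          \<not> ((\<exists>i'<i. (i', j) \<in> col_ones X C) \<and> (\<exists>j'<j. (i, j') \<in> col_ones X C))"
          using M by (cases i; cases j) simp_all
      qed
    qed blast
    also have "\<dots> \<longleftrightarrow> ?R"
      unfolding above_col_ones left_col_ones Diff_iff col_ones_iff shifted_cells_add_col_iff
      by (rule split_all)
    finally show ?thesis .
  qed
  have rule3: "(\<forall>j<Suc (snd F). (j, j) \<notin> col_ones X C \<longrightarrow> \<not> (\<exists>j'<j. (j, j') \<in> col_ones X C)) \<longleftrightarrow>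
      (\<forall>j<snd F. (j, j) \<notin> X \<longrightarrow> \<not> (\<exists>j'<j. (j, j') \<in> X)) \<and> (\<forall>j. Suc j \<in> C \<longrightarrow> j < snd F \<longrightarrow> (j, j) \<in> X)"
    unfolding All_less_Suc2 left_col_ones col_ones_iff split_bounded by simp
  have bound: "(\<forall>i\<in>C. i \<le> ferrers_length F) \<longleftrightarrow> (\<forall>i. Suc i \<in> C \<longrightarrow> i < ferrers_length F)"
    using all_nat_cases[of "\<lambda>i. i \<in> C \<longrightarrow> i \<le> ferrers_length F"] by (auto simp: Suc_le_eq)
  have "C \<subseteq> insert 0 (Suc ` open_rows F X) \<longleftrightarrow> (\<forall>i. Suc i \<in> C \<longrightarrow> i < ferrers_length F) \<and>
      (\<forall>i. Suc i \<in> C \<longrightarrow> (\<forall>j. (i, j) \<in> shifted_cells F - X \<longrightarrow> \<not> (\<exists>i'<i. (i', j) \<in> X))) \<and>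
      (\<forall>i. Suc i \<in> C \<longrightarrow> i < snd F \<longrightarrow> (i, i) \<in> X)"
    unfolding subset_Suc_image_iff open_rows_def mem_Collect_eq imp_conjR all_conj_distrib ..
  note choices = this
  show ?thesis
    unfolding ptab_def is_ferrers_add_col col_ones_subset_iff snd cols rule2 rule3 bound choices
    by (simp only: conj_ac)
qed

text \<open>The new row has no cells and is not an added row of the shifted diagram, so nothing can
  close it.\<close>

lemma open_rows_add_row: "open_rows (add_row F) X = insert (ferrers_length F) (open_rows F X)"
proof -
  have "(ferrers_length F, j) \<notin> shifted_cells F" for j
    using shifted_cells_row_bound by blast
  moreover have "snd F \<le> ferrers_length F" by (simp add: ferrers_length_def)
  moreover have "snd (add_row F) = snd F" by (simp add: add_row_def)
  ultimately show ?thesis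
    unfolding open_rows_def shifted_cells_add_row by (auto simp: less_Suc_eq)
qed

lemma card_open_rows_add_row: "card (open_rows (add_row F) X) = Suc (card (open_rows F X))"
proof -
  have "ferrers_length F \<notin> open_rows F X" by (simp add: open_rows_def)
  then show ?thesis by (simp add: open_rows_add_row finite_open_rows)
qed

text \<open>An open row with a one in the new column stays open. An open row with a zero there
  survives only if no one stands above that zero, that is, if it lies above all of \<open>C\<close>.
  Row 0 without a one is closed by its zero diagonal cell.\<close>

lemma open_rows_add_col:
  assumes C: "C \<subseteq> insert 0 (Suc ` open_rows F X)"
  shows "open_rows (add_col F) (col_ones X C) = C \<union> {i \<in> Suc ` open_rows F X. \<forall>c\<in>C. i < c}"
proof -
  have C': "i \<in> open_rows F X" if "Suc i \<in> C" for i
    using C that by auto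
  have snd: "snd (add_col F) = Suc (snd F)" by (simp add: add_col_def)
  have "i \<in> open_rows (add_col F) (col_ones X C) \<longleftrightarrow>
      i \<in> C \<union> {i \<in> Suc ` open_rows F X. \<forall>c\<in>C. i < c}" for i
  proof (cases i)
    case 0
    then show ?thesis by (auto simp: open_rows_def snd)
  next
    case (Suc i')
    have "(\<forall>j. (Suc i', j) \<in> shifted_cells (add_col F) - col_ones X C \<longrightarrow>
          \<not> (\<exists>i''<Suc i'. (i'', j) \<in> col_ones X C)) \<longleftrightarrow>
        ((Suc i', 0) \<in> shifted_cells (add_col F) - col_ones X C \<longrightarrow>
          \<not> (\<exists>i''<Suc i'. (i'', 0) \<in> col_ones X C)) \<and>
        (\<forall>j. (Suc i', Suc j) \<in> shifted_cells (add_col F) - col_ones X C \<longrightarrow>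
          \<not> (\<exists>i''<Suc i'. (i'', Suc j) \<in> col_ones X C))"
      by (rule all_nat_cases)
    then have "Suc i' \<in> open_rows (add_col F) (col_ones X C) \<longleftrightarrow>
        i' \<in> open_rows F X \<and> (Suc i' \<notin> C \<longrightarrow> \<not> (\<exists>i''<Suc i'. i'' \<in> C))"
      unfolding above_col_ones Diff_iff col_ones_iff shifted_cells_add_col_iff
      unfolding open_rows_def mem_Collect_eq snd ferrers_length_add col_ones_iff Suc_less_eq Suc_le_eq Diff_iff
      by blast
    also have "\<dots> \<longleftrightarrow> Suc i' \<in> C \<or> (i' \<in> open_rows F X \<and> (\<forall>c\<in>C. Suc i' < c))"
      using C' by (metis linorder_neqE_nat not_less_iff_gr_or_eq)
    finally show ?thesis unfolding Suc by auto
  qed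
  then show ?thesis by blast
qed

lemma card_superfluous_add_col:
  assumes "finite X" "finite C" "C \<noteq> {}"
  shows "card (superfluous (col_ones X C)) = card (superfluous X) + (card C - 1)"
proof -
  have "(i, j) \<in> superfluous (col_ones X C) \<longleftrightarrow>
      (i, j) \<in> map_prod Suc Suc ` superfluous X \<union> (C - {Min C}) \<times> {0}" for i j
  proof (cases j)
    case 0
    have "i \<in> C \<and> (\<exists>i'<i. i' \<in> C) \<longleftrightarrow> i \<in> C - {Min C}"
      using assms(2,3) by (metis Diff_iff Min_in Min_le insert_iff empty_iff linorder_not_less order_le_less)
    then show ?thesis unfolding 0 by (auto simp: superfluous_def)
  next
    case (Suc j')
    show ?thesis
    proof (cases i)
      case 0
      then show ?thesis unfolding Suc by (auto simp: superfluous_def)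
    next
      case (Suc i')
      have "(Suc i', Suc j') \<in> superfluous (col_ones X C) \<longleftrightarrow> (i', j') \<in> superfluous X"
        unfolding superfluous_def mem_Collect_eq prod.case above_col_ones by simp
      then show ?thesis unfolding Suc \<open>j = Suc j'\<close> by auto
    qed
  qed
  then have eq: "superfluous (col_ones X C) = map_prod Suc Suc ` superfluous X \<union> (C - {Min C}) \<times> {0}"
    by (simp add: set_eq_iff split_paired_all)
  have "superfluous X \<subseteq> X" by (auto simp: superfluous_def)
  then have fin: "finite (superfluous X)" using assms(1) by (rule finite_subset)
  have inj: "inj_on (map_prod Suc Suc) (superfluous X)"
    by (auto simp: inj_on_def)
  have "card (superfluous (col_ones X C)) =
      card (map_prod Suc Suc ` superfluous X) + card ((C - {Min C}) \<times> {0::nat})"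
    unfolding eq by (rule card_Un_disjoint) (use fin assms(2) in auto)
  then show ?thesis
    using assms(2,3) by (simp add: card_image[OF inj] card_cartesian_product)
qed

lemma card_diag_ones_add_col:
  "card (diag_ones (add_col F) (col_ones X C)) = (if 0 \<in> C then 1 else 0) + card (diag_ones F X)"
proof -
  have fin: "finite (diag_ones F X)" by (simp add: diag_ones_def)
  have "j \<in> diag_ones (add_col F) (col_ones X C) \<longleftrightarrow>
      j \<in> (if 0 \<in> C then {0} else {}) \<union> Suc ` diag_ones F X" for j
    by (cases j) (auto simp: diag_ones_def add_col_def)
  then have "diag_ones (add_col F) (col_ones X C) = (if 0 \<in> C then {0} else {}) \<union> Suc ` diag_ones F X"
    by blast
  moreover have "card ((if 0 \<in> C then {0} else {}) \<union> Suc ` diag_ones F X) =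
      card (if 0 \<in> C then {0::nat} else {}) + card (Suc ` diag_ones F X)"
    by (rule card_Un_disjoint) (use fin in auto)
  ultimately show ?thesis by (simp add: card_image)
qed

lemma ptab_wt_add_row: "ptab_wt Y s q (add_row F) X = Y * ptab_wt Y s q F X"
  by (simp add: ptab_wt_def add_row_def diag_ones_def mult_ac)

lemma ptab_wt_add_col:
  assumes "finite X" "finite C" "C \<noteq> {}"
  shows "ptab_wt Y s q (add_col F) (col_ones X C) =
    ptab_wt Y s q F X * ((if 0 \<in> C then s else 1) * q ^ (card C - 1))"
  unfolding ptab_wt_def card_diag_ones_add_col card_superfluous_add_col[OF assms] power_add
  by (simp add: add_col_def mult_ac)

section \<open>Recursion over the length of the tableaux\<close>

definition ptabs :: "nat \<Rightarrow> (ferrers \<times> (nat \<times> nat) set) set" where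
  "ptabs n = {(F, X). ptab F X \<and> ferrers_length F = n}"

definition col_choices :: "ferrers \<times> (nat \<times> nat) set \<Rightarrow> nat set set" where
  "col_choices = (\<lambda>(F, X). Pow (insert 0 (Suc ` open_rows F X)) - {{}})"

lemma ptabs_0: "ptabs 0 = {(([], 0), {})}"
proof -
  have "ferrers_length F = 0 \<longleftrightarrow> F = ([], 0)" for F
    by (cases F) (simp add: ferrers_length_def)
  moreover have "ptab ([], 0) X \<longleftrightarrow> X = {}" for X
    by (auto simp: ptab_def is_ferrers_def shifted_cells_def shifted_rows_def)
  ultimately show ?thesis by (auto simp: ptabs_def)
qed

text \<open>The last step of the border path decides between the two images.\<close>

lemma ptabs_Suc:
  "ptabs (Suc n) = (\<lambda>(F, X). (add_row F, X)) ` ptabs n \<union>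
     (\<lambda>((F, X), C). (add_col F, col_ones X C)) ` (SIGMA T:ptabs n. col_choices T)"
  (is "?L = ?A \<union> ?B")
proof (intro equalityI subsetI)
  fix T assume "T \<in> ?L"
  then obtain F X where T: "T = (F, X)" and pt: "ptab F X" and len: "ferrers_length F = Suc n"
    by (auto simp: ptabs_def)
  have "is_ferrers F" and sub: "X \<subseteq> shifted_cells F" using pt by (simp_all add: ptab_def)
  from this(1) len show "T \<in> ?A \<union> ?B"
  proof (cases rule: ferrers_cases)
    case (1 G)
    then have "(G, X) \<in> ptabs n" using pt len by (simp add: ptabs_def ptab_add_row)
    then show ?thesis unfolding T 1 by force
  next
    case (2 G)
    \<comment> \<open>Column 0 is split off; the rest of row 0 carries no ones because it contains
      no cells.\<close>
    define X' C where "X' = {(i, j). (Suc i, Suc j) \<in> X}" and "C = {i. (i, 0) \<in> X}"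
    have "(i, j) \<in> X \<longleftrightarrow> (i, j) \<in> col_ones X' C" for i j
    proof (cases j)
      case 0
      then show ?thesis by (simp add: C_def)
    next
      case (Suc j')
      have "(0, Suc j') \<notin> X" using sub unfolding 2 using shifted_cells_add_col_iff(2) by blast
      then show ?thesis unfolding Suc by (cases i) (simp_all add: X'_def)
    qed
    then have X: "X = col_ones X' C" by (simp add: set_eq_iff split_paired_all)
    have "(G, X') \<in> ptabs n" "C \<in> col_choices (G, X')"
      using pt len unfolding X 2 ptab_add_col by (simp_all add: ptabs_def col_choices_def)
    then show ?thesis unfolding T 2 X by force
  qed
next
  fix T assume "T \<in> ?A \<union> ?B"
  then show "T \<in> ?L"
    by (auto simp: ptabs_def col_choices_def ptab_add_row ptab_add_col)
qed

lemma finite_col_choices: "finite (col_choices T)"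
  by (cases T) (simp add: col_choices_def finite_open_rows)

lemma finite_ptabs: "finite (ptabs n)"
  by (induction n) (simp_all add: ptabs_0 ptabs_Suc finite_col_choices)

text \<open>Split by the new diagonal cell. With a one in it, no row lies above all of
  \<open>C\<close>, so the open rows are \<open>C\<close> itself; with a zero in it,
  \<open>sum_Pow_nonempty_card\<close> applies.\<close>

lemma sum_col_choices:
  fixes s q :: "'a::comm_ring_1"
  shows "(\<Sum>C\<in>col_choices (F, X). (if 0 \<in> C then s else 1) * q ^ (card C - 1) *
      g (card (C \<union> {i \<in> Suc ` open_rows F X. \<forall>c\<in>C. i < c}))) =
    s * phi q (card (open_rows F X)) (\<lambda>j. g (Suc j)) + psi q (card (open_rows F X)) g"
proof -
  let ?U = "Suc ` open_rows F X"
  let ?G = "\<lambda>C. g (card (C \<union> {i \<in> ?U. \<forall>c\<in>C. i < c}))"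
  have fin: "finite ?U" by (simp add: finite_open_rows)
  have card: "card ?U = card (open_rows F X)" by (simp add: card_image)
  have "(\<Sum>C\<in>Pow ?U. (if 0 \<in> insert 0 C then s else 1) * q ^ (card (insert 0 C) - 1) * ?G (insert 0 C)) =
      s * (\<Sum>C\<in>Pow ?U. q ^ (card (insert 0 C) - 1) * g (card (insert 0 C)))"
    unfolding sum_distrib_left by (intro sum.cong refl) (simp add: mult.assoc)
  also have "\<dots> = s * phi q (card ?U) (\<lambda>j. g (Suc j))"
    using sum_Pow_insert_card[OF fin, of 0 q g] by simp
  finally have 1: "(\<Sum>C\<in>Pow ?U. (if 0 \<in> insert 0 C then s else 1) * q ^ (card (insert 0 C) - 1) *
      ?G (insert 0 C)) = s * phi q (card ?U) (\<lambda>j. g (Suc j))" .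
  have "(\<Sum>C\<in>Pow ?U - {{}}. (if 0 \<in> C then s else 1) * q ^ (card C - 1) * ?G C) =
      (\<Sum>C\<in>Pow ?U - {{}}. q ^ (card C - 1) * ?G C)"
  proof (intro sum.cong refl)
    fix C assume "C \<in> Pow ?U - {{}}"
    then have "0 \<notin> C" by auto
    then show "(if 0 \<in> C then s else 1) * q ^ (card C - 1) * ?G C = q ^ (card C - 1) * ?G C"
      by simp
  qed
  also have "\<dots> = psi q (card ?U) g"
    by (rule sum_Pow_nonempty_card[OF fin])
  finally have 2: "(\<Sum>C\<in>Pow ?U - {{}}. (if 0 \<in> C then s else 1) * q ^ (card C - 1) * ?G C) =
    psi q (card ?U) g" .
  have "0 \<notin> ?U" by auto
  show ?thesis
    unfolding col_choices_def prod.case sum_Pow_insert_nonempty[OF fin \<open>0 \<notin> ?U\<close>] 1 2 card ..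
qed

text \<open>Only the number of open rows enters the recursion, so an arbitrary weight
  \<open>g\<close> of that number can be carried along.\<close>

lemma sum_ptabs_Suc:
  fixes Y s q :: "'a::comm_ring_1"
  shows "(\<Sum>(F, X)\<in>ptabs (Suc n). ptab_wt Y s q F X * g (card (open_rows F X))) =
    (\<Sum>(F, X)\<in>ptabs n. ptab_wt Y s q F X * (Y * g (Suc (card (open_rows F X))) +
      s * phi q (card (open_rows F X)) (\<lambda>j. g (Suc j)) + psi q (card (open_rows F X)) g))"
proof -
  let ?f = "\<lambda>(F, X). ptab_wt Y s q F X * g (card (open_rows F X))"
  let ?r = "\<lambda>(F, X). (add_row F, X)" and ?c = "\<lambda>((F, X), C). (add_col F, col_ones X C)"
  let ?S = "SIGMA T:ptabs n. col_choices T"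
  have finS: "finite ?S" using finite_ptabs finite_col_choices by (rule finite_SigmaI)
  have "sum ?f (ptabs (Suc n)) = sum ?f (?r ` ptabs n) + sum ?f (?c ` ?S)"
    unfolding ptabs_Suc
  proof (rule sum.union_disjoint)
    have "?r P \<noteq> ?c Q" for P Q
      using add_row_neq_add_col by (simp add: case_prod_unfold)
    then show "?r ` ptabs n \<inter> ?c ` ?S = {}" by blast
  qed (use finite_ptabs finS in simp_all)
  also have "sum ?f (?r ` ptabs n) = (\<Sum>(F, X)\<in>ptabs n. ptab_wt Y s q F X * (Y * g (Suc (card (open_rows F X)))))"
  proof (rule sum.reindex_cong[of ?r])
    show "inj_on ?r (ptabs n)" by (auto simp: inj_on_def dest: inj_add_row)
  qed (auto simp: ptab_wt_add_row card_open_rows_add_row mult_ac)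
  also have "sum ?f (?c ` ?S) = (\<Sum>((F, X), C)\<in>?S. ptab_wt Y s q F X *
      ((if 0 \<in> C then s else 1) * q ^ (card C - 1) *
      g (card (C \<union> {i \<in> Suc ` open_rows F X. \<forall>c\<in>C. i < c}))))"
  proof (rule sum.reindex_cong[of ?c])
    show "inj_on ?c ?S"
      by (auto simp: inj_on_def dest!: inj_add_col col_ones_inject)
    fix T assume "T \<in> ?S"
    then obtain F X C where T: "T = ((F, X), C)" and pt: "ptab F X" and C: "C \<in> col_choices (F, X)"
      by (auto simp: ptabs_def)
    have X: "finite X"
      using pt by (intro finite_subset[OF _ finite_shifted_cells[of F]]) (simp add: ptab_def)
    have C': "C \<subseteq> insert 0 (Suc ` open_rows F X)" "C \<noteq> {}" using C by (simp_all add: col_choices_def)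
    have "finite C" by (rule finite_subset[OF C'(1)]) (simp add: finite_open_rows)
    then show "?f (?c T) = (\<lambda>((F, X), C). ptab_wt Y s q F X *
      ((if 0 \<in> C then s else 1) * q ^ (card C - 1) *
      g (card (C \<union> {i \<in> Suc ` open_rows F X. \<forall>c\<in>C. i < c})))) T"
      unfolding T prod.case open_rows_add_col[OF C'(1)] ptab_wt_add_col[OF X \<open>finite C\<close> C'(2)]
      by (simp only: mult.assoc)
  qed simp
  also have "\<dots> = (\<Sum>T\<in>ptabs n. \<Sum>C\<in>col_choices T. case T of (F, X) \<Rightarrow> ptab_wt Y s q F X *
      ((if 0 \<in> C then s else 1) * q ^ (card C - 1) *
      g (card (C \<union> {i \<in> Suc ` open_rows F X. \<forall>c\<in>C. i < c}))))"
    by (subst sum.Sigma) (auto simp: finite_ptabs finite_col_choices intro!: sum.cong)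
  also have "\<dots> = (\<Sum>(F, X)\<in>ptabs n. ptab_wt Y s q F X *
      (s * phi q (card (open_rows F X)) (\<lambda>j. g (Suc j)) + psi q (card (open_rows F X)) g))"
    by (intro sum.cong refl) (auto simp only: prod.case sum_distrib_left[symmetric] sum_col_choices split: prod.split)
  finally show ?thesis
    by (simp only: sum.distrib[symmetric] case_prod_unfold distrib_left add.assoc)
qed

text \<open>A tableau with \<open>u\<close> open rows is weighted by \<open>D\<^sup>u w\<close>. An
  empty row multiplies this by \<open>Y D\<close>, and all new columns together act as
  \<open>E\<close> by \<open>opE_opD_funpow_neg_wt\<close>; the sum of both is
  \<open>opM\<close>.\<close>

lemma sum_ptabs_opM:
  "(\<Sum>(F, X)\<in>ptabs n. ptab_wt Y s q F X * (opD q ^^ card (open_rows F X)) (neg_wt s q) h) =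
    (opM Y q ^^ n) (neg_wt s q) h"
proof (induction n arbitrary: h)
  case 0
  have "open_rows ([], 0) {} = {}" by (simp add: open_rows_def ferrers_length_def)
  then show ?case
    by (simp add: ptabs_0 ptab_wt_def diag_ones_def superfluous_def)
next
  case (Suc n)
  let ?w = "neg_wt s q"
  have "(\<Sum>(F, X)\<in>ptabs (Suc n). ptab_wt Y s q F X * (opD q ^^ card (open_rows F X)) ?w h) =
      (\<Sum>(F, X)\<in>ptabs n. ptab_wt Y s q F X * opM Y q ((opD q ^^ card (open_rows F X)) ?w) h)"
    unfolding sum_ptabs_Suc[of Y s q "\<lambda>u. (opD q ^^ u) ?w h"]
    by (intro sum.cong refl) (simp add: opM_def opE_opD_funpow_neg_wt add_ac split: prod.split)
  also have "\<dots> = opM Y q (\<lambda>h. \<Sum>(F, X)\<in>ptabs n. ptab_wt Y s q F X * (opD q ^^ card (open_rows F X)) ?w h) h"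
    unfolding case_prod_unfold opM_sum ..
  \<comment> \<open>The induction hypothesis is needed for all \<open>h\<close> at once, as
    \<open>opM\<close> mixes neighbouring arguments.\<close>
  also have "\<dots> = (opM Y q ^^ Suc n) ?w h"
    unfolding Suc.IH by simp
  finally show ?case .
qed

text \<open>At 0 the operator \<open>opD\<close> does not change the value, since
  \<open>qint q 1 = 1\<close> and \<open>qint q 0 = 0\<close>. Thus the auxiliary weight disappears
  at \<open>h = 0\<close>.\<close>

lemma opD_funpow_neg_wt_0: "(opD q ^^ u) (neg_wt s q) 0 = 1"
  by (induction u) (simp_all add: neg_wt_def opD_def qint_Suc)

lemma sum_ptabs: "(\<Sum>(F, X)\<in>ptabs n. ptab_wt Y s q F X) = (opM Y q ^^ n) (neg_wt s q) 0"
  using sum_ptabs_opM[of Y s q 0 n] by (simp add: opD_funpow_neg_wt_0)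

section \<open>From sets of ones back to fillings\<close>

definition ones :: "tableau \<Rightarrow> (nat \<times> nat) set" where
  "ones T = {c \<in> shifted_cells (fst T). snd T c = 1}"

text \<open>The value \<open>undefined\<close> off the diagram is what the extensional function
  space in \<open>PT_B\<close> demands.\<close>

definition filling :: "ferrers \<Rightarrow> (nat \<times> nat) set \<Rightarrow> nat \<times> nat \<Rightarrow> nat" where
  "filling F X = (\<lambda>c. if c \<in> shifted_cells F then if c \<in> X then 1 else 0 else undefined)"

lemma one_above_iff: "one_above T i j \<longleftrightarrow> (\<exists>i'<i. (i', j) \<in> ones T)"
  by (simp add: one_above_def ones_def)

lemma one_left_iff: "one_left T i j \<longleftrightarrow> (\<exists>j'<j. (i, j') \<in> ones T)"
  by (simp add: one_left_def ones_def)

lemma PT_B_iff: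
  "T \<in> PT_B n \<longleftrightarrow> snd T \<in> shifted_cells (fst T) \<rightarrow>\<^sub>E {0, 1} \<and> (fst T, ones T) \<in> ptabs n"
proof (cases "snd T \<in> shifted_cells (fst T) \<rightarrow>\<^sub>E {0, 1}")
  case True
  then have zero: "snd T c = 0 \<longleftrightarrow> c \<notin> ones T" if "c \<in> shifted_cells (fst T)" for c
    using that PiE_mem[OF True that] by (auto simp: ones_def)
  have cells: "(\<forall>(i, j)\<in>shifted_cells (fst T). snd T (i, j) = 0 \<longrightarrow> \<not> (one_above T i j \<and> one_left T i j)) \<longleftrightarrow>
      (\<forall>i j. (i, j) \<in> shifted_cells (fst T) - ones T \<longrightarrow>
        \<not> ((\<exists>i'<i. (i', j) \<in> ones T) \<and> (\<exists>j'<j. (i, j') \<in> ones T)))"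
    using zero unfolding one_above_iff one_left_iff by (simp add: Ball_def imp_conjL)
  have "(j, j) \<in> shifted_cells (fst T)" if "j < snd (fst T)" for j
    using that diagonal_cells_subset[of "fst T"] by (auto simp: diagonal_cells_def)
  then have diag: "(\<forall>(i, j)\<in>diagonal_cells (fst T). snd T (i, j) = 0 \<longrightarrow> \<not> one_left T i j) \<longleftrightarrow>
      (\<forall>j<snd (fst T). (j, j) \<notin> ones T \<longrightarrow> \<not> (\<exists>j'<j. (j, j') \<in> ones T))"
    using zero unfolding one_left_iff diagonal_cells_def by auto
  have cols: "(\<forall>j<snd (fst T). \<exists>i. (i, j) \<in> shifted_cells (fst T) \<and> snd T (i, j) = 1) \<longleftrightarrow>
      (\<forall>j<snd (fst T). \<exists>i. (i, j) \<in> ones T)"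
    by (simp add: ones_def)
  have "ones T \<subseteq> shifted_cells (fst T)" by (auto simp: ones_def)
  then show ?thesis
    using True unfolding PT_B_def ptabs_def ptab_def mem_Collect_eq prod.case cells diag cols
    by blast
next
  case False
  then show ?thesis by (simp add: PT_B_def)
qed

lemma bij_betw_ones: "bij_betw (\<lambda>T. (fst T, ones T)) (PT_B n) (ptabs n)"
proof -
  have filling_one: "filling F X c = 1 \<longleftrightarrow> c \<in> X" if "c \<in> shifted_cells F" for F X c
    using that by (cases "c \<in> X") (simp_all add: filling_def)
  have inv: "ones (F, filling F X) = X" if "(F, X) \<in> ptabs n" for F X
  proof -
    have "X \<subseteq> shifted_cells F" using that by (simp add: ptabs_def ptab_def)
    then show ?thesis
      unfolding ones_def fst_conv snd_conv using filling_one[of _ F X] by blast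
  qed
  have fill: "filling F X \<in> shifted_cells F \<rightarrow>\<^sub>E {0, 1}" for F X
    by (rule PiE_I) (simp_all add: filling_def)
  have inv': "filling (fst T) (ones T) = snd T" if "snd T \<in> shifted_cells (fst T) \<rightarrow>\<^sub>E {0, 1}" for T
  proof
    show "filling (fst T) (ones T) c = snd T c" for c
      using PiE_mem[OF that, of c] PiE_arb[OF that, of c] by (auto simp: filling_def ones_def)
  qed
  show ?thesis
  proof (rule bij_betw_byWitness[of _ "\<lambda>(F, X). (F, filling F X)"])
    show "\<forall>T\<in>PT_B n. (\<lambda>(F, X). (F, filling F X)) (fst T, ones T) = T"
      using inv' by (simp add: PT_B_iff)
    show "\<forall>P\<in>ptabs n. (\<lambda>T. (fst T, ones T)) ((\<lambda>(F, X). (F, filling F X)) P) = P"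
      using inv by auto
    show "(\<lambda>T. (fst T, ones T)) ` PT_B n \<subseteq> ptabs n"
      by (auto simp: PT_B_iff)
    show "(\<lambda>(F, X). (F, filling F X)) ` ptabs n \<subseteq> PT_B n"
      using inv fill by (auto simp: PT_B_iff)
  qed
qed

lemma ptab_wt_ones:
  "ptab_wt Y s q (fst T) (ones T) = Y ^ tab_row T * s ^ tab_diag T * q ^ tab_so T"
proof -
  have "superfluous (ones T) = {(i, j). (i, j) \<in> shifted_cells (fst T) \<and> snd T (i, j) = 1 \<and> one_above T i j}"
    unfolding superfluous_def one_above_iff by (auto simp: ones_def)
  moreover have "{c \<in> diagonal_cells (fst T). snd T c = 1} = (\<lambda>j. (j, j)) ` diag_ones (fst T) (ones T)"
    using diagonal_cells_subset[of "fst T"] by (auto simp: diag_ones_def ones_def diagonal_cells_def)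
  moreover have "inj_on (\<lambda>j. (j, j)) A" for A :: "nat set" by (simp add: inj_on_def)
  ultimately show ?thesis
    by (simp add: ptab_wt_def tab_row_def tab_so_def tab_diag_def card_image)
qed

lemma sum_PT_B:
  "(\<Sum>T\<in>PT_B n. Y ^ tab_row T * s ^ tab_diag T * q ^ tab_so T) = (opM Y q ^^ n) (neg_wt s q) 0"
  unfolding sum_ptabs[symmetric] sum.reindex_bij_betw[OF bij_betw_ones, symmetric] prod.case ptab_wt_ones ..

lemma sum_PT_B_eq_sum_signed_perms:
  fixes y t q :: "'a :: comm_ring_1"
  shows "(\<Sum>T\<in>PT_B n. y ^ (2 * tab_row T + tab_diag T) * t ^ tab_diag T * q ^ tab_so T) =
    (\<Sum>w\<in>signed_perms n. y ^ sp_fwex w * t ^ sp_neg w * q ^ sp_cro w)"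
proof -
  \<comment> \<open>The substitution \<open>Y = y\<^sup>2\<close>, \<open>s = y * t\<close>, valid
    for both sides because \<open>fwex\<close> and the exponent of \<open>y\<close> for tableaux
    have the same form.\<close>
  have wt: "y ^ (2 * a + b) * t ^ b * q ^ c = (y\<^sup>2) ^ a * (y * t) ^ b * q ^ c" for a b c
    unfolding power_add power_mult[of y 2] power_mult_distrib by (simp only: mult_ac)
  show ?thesis
    unfolding sp_fwex_def wt sum_PT_B sum_signed_perms ..
qed

theorem theorem1p1:
  fixes n :: nat and y t q :: "'a :: comm_ring_1"
  shows "(\<Sum>T\<in>PT_B n. y ^ (2 * tab_row T + tab_diag T) * t ^ tab_diag T * q ^ tab_so T) =
           (\<Sum>w\<in>signed_perms n. y ^ sp_fwex w * t ^ sp_neg w * q ^ sp_cro w) \<and>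
         (\<forall>k. coeff (\<Sum>T\<in>PT_B n. monom (t ^ tab_diag T * q ^ tab_so T) (2 * tab_row T + tab_diag T)) k =
           (\<Sum>w\<in>{w \<in> signed_perms n. sp_fwex w = k}. t ^ sp_neg w * q ^ sp_cro w))"
proof (intro conjI allI)
  show "(\<Sum>T\<in>PT_B n. y ^ (2 * tab_row T + tab_diag T) * t ^ tab_diag T * q ^ tab_so T) =
      (\<Sum>w\<in>signed_perms n. y ^ sp_fwex w * t ^ sp_neg w * q ^ sp_cro w)"
    by (rule sum_PT_B_eq_sum_signed_perms)
  fix k
  \<comment> \<open>The identity is reused in the polynomial ring, with the indeterminate for
    \<open>y\<close> and constant polynomials for \<open>t\<close> and \<open>q\<close>; comparing
    coefficients then gives the refined form.\<close>
  have monom: "monom (t ^ b * q ^ c) a = monom 1 1 ^ a * [:t:] ^ b * [:q:] ^ c" for a b c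
    by (simp add: monom_power flip: monom_0) (simp add: monom_power mult_monom)
  have "(\<Sum>T\<in>PT_B n. monom (t ^ tab_diag T * q ^ tab_so T) (2 * tab_row T + tab_diag T)) =
      (\<Sum>w\<in>signed_perms n. monom (t ^ sp_neg w * q ^ sp_cro w) (sp_fwex w))"
    unfolding monom by (rule sum_PT_B_eq_sum_signed_perms)
  then show "coeff (\<Sum>T\<in>PT_B n. monom (t ^ tab_diag T * q ^ tab_so T) (2 * tab_row T + tab_diag T)) k =
      (\<Sum>w\<in>{w \<in> signed_perms n. sp_fwex w = k}. t ^ sp_neg w * q ^ sp_cro w)"
    by (simp add: coeff_sum finite_signed_perms sum.If_cases Int_def)
qed

end
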